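(* The ZVA-$\Delta$ estimator has vanishing relative error and the ZVA-$\bar d$ estimator has bounded relative error. That is, for a nonnegative function $v$ on $\mathcal X$ let $\mathbb Q$ be the path measure built from $v$ and $L_{\mathbb Q}=\mathbb P/\mathbb Q$ (see context), and put $R_v(\epsilon)=\operatorname{Var}_{\mathbb Q}(L_{\mathbb Q}\mathbf 1_\Phi)/(\mathbb E_{\mathbb Q}(L_{\mathbb Q}\mathbf 1_\Phi))^2$. Then: (i) (ZVA-$\Delta$) for $v(x)=\sum_{\omega\in\Delta(x)}\bar{\mathbb P}(\omega)$, $\lim_{\epsilon\downarrow0}R_v(\epsilon)=0$; (ii) (ZVA-$\bar d$) for $v(x)=\epsilon^{\bar d(x,g)}$, $R_v(\epsilon)=O(1)$ as $\epsilon\downarrow0$.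
   Context: Markov chain. $\mathcal X$ is a (possibly infinite) countable state space with distinguished states $s$ (initial), $g$ (goal), $t$ (taboo), $s\ne g$, $s\neq t$, and $g,t$ absorbing ($p_{gg}=p_{tt}=1$). The transition probabilities $p_{xz}=p_{xz}(\epsilon)$ depend on a small parameter $\epsilon>0$; for each $x,z$ either $p_{xz}=0$, and then $r_{xz}=\infty$, or $p_{xz}(\epsilon)>0$ with $p_{xz}(\epsilon)=\Theta(\epsilon^{r_{xz}})$ for some $r_{xz}\in\mathbb N=\{0,1,2,\dots\}$. The state space and its transition structure do not depend on $\epsilon$. Here $f=\Theta(h)$ means $0<\lim_{\epsilon\downarrow0}f(\epsilon)/h(\epsilon)<\infty$, $f=O(h)$ means $\lim_{\epsilon\downarrow0}f(\epsilon)/h(\epsilon)<\infty$, and $\epsilon^\infty=0$. Paths. A path $\omega$ is a finite sequence $\omega(0),\dots,\omega(n_\omega)$ of states, with $n_\omega\ge0$ steps, and $\mathbb P(\omega)=\prod_{i=1}^{n_\omega}p_{\omega(i-1)\omega(i)}$. Distance: $d(x,z)$ is the minimum of those $r\in\mathbb N$ for which there is a path $\omega$ with $\omega(0)=x$, $\omega(n_\omega)=z$, $\omega(k)\notin\{t,g\}$ for all $k<n_\omega$, and $\mathbb P(\omega)=\Theta(\epsilon^r)$; $d(x,z)=\infty$ if there is none. $\Phi(x)$ is the set of paths with $\omega(0)=x$, $\omega(n_\omega)=g$, $\omega(k)\notin\{t,g\}$ for $k<n_\omega$; $\Phi=\Phi(s)$. Sets. $\Lambda=\{x\in\mathcal X: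 d(s,x)\le d(s,g)\}$, $\Gamma=\{x\in\mathcal X\setminus\Lambda:\exists z\in\Lambda,\ p_{zx}>0\}$. Modified chain: $\bar p_{xz}=p_{xz}$ if $x\notin\Gamma$; $\bar p_{xg}=1$ and $\bar p_{xz}=0$ for $z\ne g$ if $x\in\Gamma$. $\bar{\mathbb P}$ and $\bar d$ are defined as $\mathbb P$ and $d$ with $\bar p$ in place of $p$. Dominant paths: $\Delta(x)=\{\omega\in\Phi(x):\bar{\mathbb P}(\omega)=\Theta(\epsilon^{\bar d(x,g)})\}$; if $\bar d(x,g)=\infty$ the sum over $\Delta(x)$ is $0$. (Only the values of $v$ on $\Lambda\cup\Gamma$ matter below.) Importance sampling measure. For a path $\omega$ let $m(\omega)=\min\{i:\omega(i)\notin\Lambda\text{ or }\omega(i)=g\}$ ($=\infty$ if there is no such $i$). Then $\mathbb Q(\omega)=\prod_{i=0}^{n_\omega-1}q_{\omega(i)\omega(i+1)}$, where $q_{\omega(i)\omega(i+1)}=\bar p_{\omega(i)\omega(i+1)}v(\omega(i+1))\big/\sum_{z\in\mathcal X}\bar p_{\omega(i)z}v(z)$ if $i<m(\omega)$, and $q_{\omega(i)\omega(i+1)}=p_{\omega(i)\omega(i+1)}$ if $i\ge m(\omega)$. (A path entering, before $m(\omega)$, a state where the denominator vanishes has $\mathbb Q(\omega)=0$.) A random path is drawn under $\mathbb Q$ from $s$ until it first hits $g$ or $t$; $\mathbf 1_\Phi$ indicates that it hits $g$; $L_{\mathbb Q}(\omega)=\mathbb P(\omega)/\mathbb Q(\omega)$.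 Expectation and variance under $\mathbb Q$ refer to this random path; e.g. $\mathbb E_{\mathbb Q}(L_{\mathbb Q}^k\mathbf 1_\Phi)=\sum_{\omega\in\Phi,\ \mathbb Q(\omega)>0}\mathbb Q(\omega)(\mathbb P(\omega)/\mathbb Q(\omega))^k$. The relative error of the estimator is bounded (vanishing) iff $R_v$ is bounded (tends to $0$) as $\epsilon\downarrow0$. Standing assumptions. $\Lambda$ and $\Gamma$ are finite; $d(s,g)<\infty$; under $\mathbb P$ the chain from $s$ reaches $\{t,g\}$ in finite time with probability 1; the chain has no high-probability cycle, i.e. no path with $n_\omega\ge1$, $\omega(n_\omega)=\omega(0)$ and $\mathbb P(\omega)=\Theta(\epsilon^0)$, other than the self-loops at the absorbing states $g,t$. *)

theory Defs
  imports "HOL-Probability.Probability"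
begin

text \<open>
  A chain depending on a parameter: \<open>pmf (K \<epsilon> x) z\<close> is the transition probability
  $p_{xz}(\epsilon)$.  The state space is the whole (countable) type; values of \<open>K\<close> at
  parameters that are not small and positive play no role.
\<close>

type_synonym 'a chain = "real \<Rightarrow> 'a \<Rightarrow> 'a pmf"

text \<open>
  Here \<open>Theta\<close> and \<open>O\<close> are defined by the existence of limits, which is more demanding than
  the two-sided and one-sided bounds of the Landau symbols of the library.  The second one is
  for extended values, so that an infinite relative error is not mistaken for a bounded one.
\<close>

definition is_Theta :: "(real \<Rightarrow> real) \<Rightarrow> (real \<Rightarrow> real) \<Rightarrow> bool" where
  "is_Theta f h \<longleftrightarrow> (\<exists>c>0. ((\<lambda>\<epsilon>. f \<epsilon> / h \<epsilon>) \<longlongrightarrow> c) (at_right 0))"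

definition is_O :: "(real \<Rightarrow> ennreal) \<Rightarrow> (real \<Rightarrow> ennreal) \<Rightarrow> bool" where
  "is_O f h \<longleftrightarrow> (\<exists>c<\<infinity>. ((\<lambda>\<epsilon>. f \<epsilon> / h \<epsilon>) \<longlongrightarrow> c) (at_right 0))"

text \<open>A path is a nonempty list \<open>\<omega>\<close>; it has \<open>length \<omega> - 1\<close> steps.\<close>

definition path_prob :: "'a chain \<Rightarrow> real \<Rightarrow> 'a list \<Rightarrow> real" where
  "path_prob K \<epsilon> \<omega> = (\<Prod>i<length \<omega> - 1. pmf (K \<epsilon> (\<omega> ! i)) (\<omega> ! Suc i))"

definition paths_between :: "'a \<Rightarrow> 'a \<Rightarrow> 'a \<Rightarrow> 'a \<Rightarrow> 'a list set" where
  "paths_between g t x z =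
     {\<omega>. \<omega> \<noteq> [] \<and> hd \<omega> = x \<and> last \<omega> = z \<and> (\<forall>k<length \<omega> - 1. \<omega> ! k \<notin> {t, g})}"

definition Phi :: "'a \<Rightarrow> 'a \<Rightarrow> 'a \<Rightarrow> 'a list set" where
  "Phi g t x = paths_between g t x g"

text \<open>The possible values of the random path from \<open>x\<close> stopped on first hitting \<open>g\<close> or \<open>t\<close>.\<close>

definition stopped_paths :: "'a \<Rightarrow> 'a \<Rightarrow> 'a \<Rightarrow> 'a list set" where
  "stopped_paths g t x = paths_between g t x g \<union> paths_between g t x t"

definition dis :: "'a chain \<Rightarrow> 'a \<Rightarrow> 'a \<Rightarrow> 'a \<Rightarrow> 'a \<Rightarrow> enat" where
  "dis K g t x z =
     Inf {enat r | r. \<exists>\<omega>\<in>paths_between g t x z.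
                        is_Theta (\<lambda>\<epsilon>. path_prob K \<epsilon> \<omega>) (\<lambda>\<epsilon>. \<epsilon> ^ r)}"

definition Lam :: "'a chain \<Rightarrow> 'a \<Rightarrow> 'a \<Rightarrow> 'a \<Rightarrow> 'a set" where
  "Lam K s g t = {x. dis K g t s x \<le> dis K g t s g}"

text \<open>
  Whether a transition probability is positive will not depend on \<open>\<epsilon>\<close> once \<open>\<epsilon>\<close> is small.
\<close>

definition Gam :: "'a chain \<Rightarrow> 'a \<Rightarrow> 'a \<Rightarrow> 'a \<Rightarrow> 'a set" where
  "Gam K s g t =
     {x. x \<notin> Lam K s g t \<and>
         (\<exists>z\<in>Lam K s g t. eventually (\<lambda>\<epsilon>. pmf (K \<epsilon> z) x > 0) (at_right 0))}"

definition mod_chain :: "'a chain \<Rightarrow> 'a \<Rightarrow> 'a \<Rightarrow> 'a \<Rightarrow> 'a chain" where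
  "mod_chain K s g t = (\<lambda>\<epsilon> x. if x \<in> Gam K s g t then return_pmf g else K \<epsilon> x)"

definition dis_bar :: "'a chain \<Rightarrow> 'a \<Rightarrow> 'a \<Rightarrow> 'a \<Rightarrow> 'a \<Rightarrow> 'a \<Rightarrow> enat" where
  "dis_bar K s g t = dis (mod_chain K s g t) g t"

text \<open>Empty if the distance from \<open>x\<close> to \<open>g\<close> is infinite.\<close>

definition Delta :: "'a chain \<Rightarrow> 'a \<Rightarrow> 'a \<Rightarrow> 'a \<Rightarrow> 'a \<Rightarrow> 'a list set" where
  "Delta K s g t x =
     {\<omega> \<in> Phi g t x. \<exists>r. dis_bar K s g t x g = enat r \<and>
        is_Theta (\<lambda>\<epsilon>. path_prob (mod_chain K s g t) \<epsilon> \<omega>) (\<lambda>\<epsilon>. \<epsilon> ^ r)}"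

text \<open>
  The sum always converges: the paths in \<open>Phi g t x\<close> are the ways to hit \<open>g\<close> for the first
  time, so their probabilities add up to at most 1.
\<close>

definition v_Delta :: "'a chain \<Rightarrow> 'a \<Rightarrow> 'a \<Rightarrow> 'a \<Rightarrow> real \<Rightarrow> 'a \<Rightarrow> real" where
  "v_Delta K s g t \<epsilon> x = (\<Sum>\<^sub>\<infinity>\<omega>\<in>Delta K s g t x. path_prob (mod_chain K s g t) \<epsilon> \<omega>)"

definition v_dbar :: "'a chain \<Rightarrow> 'a \<Rightarrow> 'a \<Rightarrow> 'a \<Rightarrow> real \<Rightarrow> 'a \<Rightarrow> real" where
  "v_dbar K s g t \<epsilon> x = (case dis_bar K s g t x g of enat r \<Rightarrow> \<epsilon> ^ r | \<infinity> \<Rightarrow> 0)"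

definition exit_index :: "'a chain \<Rightarrow> 'a \<Rightarrow> 'a \<Rightarrow> 'a \<Rightarrow> 'a list \<Rightarrow> enat" where
  "exit_index K s g t \<omega> = Inf {enat i | i. i < length \<omega> \<and> (\<omega> ! i \<notin> Lam K s g t \<or> \<omega> ! i = g)}"

text \<open>
  The probability of the \<open>i\<close>-th step of \<open>\<omega>\<close> under the importance sampling measure built from
  \<open>v\<close>.  It is 0 if the denominator vanishes.  The series has finitely many nonzero terms
  whenever it matters, as then \<open>\<omega> ! i\<close> is in \<open>Lam\<close> and its successors are in the finite set
  \<open>Lam \<union> Gam\<close>.
\<close>

definition q_step ::
  "'a chain \<Rightarrow> 'a \<Rightarrow> 'a \<Rightarrow> 'a \<Rightarrow> (real \<Rightarrow> 'a \<Rightarrow> real) \<Rightarrow> real \<Rightarrow> 'a list \<Rightarrow> nat \<Rightarrow> real" where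
  "q_step K s g t v \<epsilon> \<omega> i =
     (if enat i < exit_index K s g t \<omega>
      then pmf (mod_chain K s g t \<epsilon> (\<omega> ! i)) (\<omega> ! Suc i) * v \<epsilon> (\<omega> ! Suc i) /
           (\<Sum>\<^sub>\<infinity>z. pmf (mod_chain K s g t \<epsilon> (\<omega> ! i)) z * v \<epsilon> z)
      else pmf (K \<epsilon> (\<omega> ! i)) (\<omega> ! Suc i))"

definition path_prob_Q ::
  "'a chain \<Rightarrow> 'a \<Rightarrow> 'a \<Rightarrow> 'a \<Rightarrow> (real \<Rightarrow> 'a \<Rightarrow> real) \<Rightarrow> real \<Rightarrow> 'a list \<Rightarrow> real" where
  "path_prob_Q K s g t v \<epsilon> \<omega> = (\<Prod>i<length \<omega> - 1. q_step K s g t v \<epsilon> \<omega> i)"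

text \<open>
  Expectation of a nonnegative function of the stopped path that vanishes on trajectories that
  never reach \<open>g\<close> or \<open>t\<close>.  It takes the value \<open>\<infinity>\<close> if the series diverges.
\<close>

definition expect_Q ::
  "'a chain \<Rightarrow> 'a \<Rightarrow> 'a \<Rightarrow> 'a \<Rightarrow> (real \<Rightarrow> 'a \<Rightarrow> real) \<Rightarrow> real \<Rightarrow> ('a list \<Rightarrow> real) \<Rightarrow> ennreal" where
  "expect_Q K s g t v \<epsilon> F =
     (\<integral>\<^sup>+ \<omega>. ennreal (path_prob_Q K s g t v \<epsilon> \<omega> * F \<omega>) \<partial>count_space (stopped_paths g t s))"

text \<open>
  The likelihood ratio times the indicator of \<open>Phi\<close>.  Where the denominator is 0 the value is
  irrelevant, because such paths have no weight in the expectation.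
\<close>

definition estimator ::
  "'a chain \<Rightarrow> 'a \<Rightarrow> 'a \<Rightarrow> 'a \<Rightarrow> (real \<Rightarrow> 'a \<Rightarrow> real) \<Rightarrow> real \<Rightarrow> 'a list \<Rightarrow> real" where
  "estimator K s g t v \<epsilon> \<omega> =
     path_prob K \<epsilon> \<omega> / path_prob_Q K s g t v \<epsilon> \<omega> * indicator (Phi g t s) \<omega>"

text \<open>
  The subtraction in \<^typ>\<open>ennreal\<close> never truncates, by the Cauchy-Schwarz inequality, since the
  total mass is at most 1; the subtracted expectation is at most 1, hence finite.
\<close>

definition variance_Q ::
  "'a chain \<Rightarrow> 'a \<Rightarrow> 'a \<Rightarrow> 'a \<Rightarrow> (real \<Rightarrow> 'a \<Rightarrow> real) \<Rightarrow> real \<Rightarrow> ennreal" where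
  "variance_Q K s g t v \<epsilon> =
     expect_Q K s g t v \<epsilon> (\<lambda>\<omega>. (estimator K s g t v \<epsilon> \<omega>)\<^sup>2) -
     (expect_Q K s g t v \<epsilon> (estimator K s g t v \<epsilon>))\<^sup>2"

definition rel_error ::
  "'a chain \<Rightarrow> 'a \<Rightarrow> 'a \<Rightarrow> 'a \<Rightarrow> (real \<Rightarrow> 'a \<Rightarrow> real) \<Rightarrow> real \<Rightarrow> ennreal" where
  "rel_error K s g t v \<epsilon> =
     variance_Q K s g t v \<epsilon> / (expect_Q K s g t v \<epsilon> (estimator K s g t v \<epsilon>))\<^sup>2"

end

(*
  Before leaving Lam, a path to g has likelihood ratio v(s) * prod rho(x), where the product runs
  over the states x visited and rho(x) = sum_z pbar_xz v(z) / v(x) converges to some gamma(x).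
  The first two moments of the estimator are thus sums of path probabilities, weighted by 1 and
  by v(s) * prod rho(x).  Write d = d(s,g) = dbar(s,g).  The dominant paths from s are finitely
  many, stay in Lam, and contribute terms equivalent to multiples of eps^d.  All other paths
  together contribute O(eps^(d+1)), also under bounded weights: since cycles in Lam cost at least
  one power of eps, there is an explicit superharmonic function of the state and the cost still to
  be spent.  So the relative error converges.  For v = v_Delta the limit of v(s) / eps^d is that
  of P(Phi) / eps^d, and rho tends to 1, so that the limit of the relative error is 0.
*)
theory Submission
  imports Defs
begin

section \<open>Paths and their asymptotic probability\<close>

text \<open>Inside \<open>Lam\<close> a step has p/q = rho(x) v(x) / v(y). These quotients
  telescope, and v is 1 wherever a path to g can exit, so only v(s) and the product of the rho
  survive. Two obstacles shape the estimate of the nondominant paths. They have unbounded length,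
  and the limits of rho may exceed 1, so no constant bounds their weights; the potential must
  instead absorb a factor G at every single step. Steps of rate 0 bring no power of eps to pay for
  this, but they can only occur in runs of bounded length. Outside \<open>Lam\<close> the state
  space may be infinite, and the Theta relations come without uniform constants. Hence only the cost
  spent up to the exit is counted, and the remainder of the path is estimated by total probability
  at most 1. Nothing is lost: by the triangle inequality, a path from s that leaves
  \<open>Lam\<close> has spent more than d by then.\<close>

definition edge :: "'a chain \<Rightarrow> 'a \<Rightarrow> 'a \<Rightarrow> bool" where
  "edge M x z \<longleftrightarrow> eventually (\<lambda>\<epsilon>. pmf (M \<epsilon> x) z > 0) (at_right 0)"

text \<open>The choice is determined for edges, since the exponent is unique, and arbitrary
  otherwise; \<open>cost\<close> is therefore always used together with \<open>walk\<close>.\<close>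

definition rate :: "'a chain \<Rightarrow> 'a \<Rightarrow> 'a \<Rightarrow> nat" where
  "rate M x z = (SOME r. is_Theta (\<lambda>\<epsilon>. pmf (M \<epsilon> x) z) (\<lambda>\<epsilon>. \<epsilon> ^ r))"

definition step_coeff :: "'a chain \<Rightarrow> 'a \<Rightarrow> 'a \<Rightarrow> real" where
  "step_coeff M x z = Lim (at_right 0) (\<lambda>\<epsilon>. pmf (M \<epsilon> x) z / \<epsilon> ^ rate M x z)"

abbreviation walk :: "'a chain \<Rightarrow> 'a list \<Rightarrow> bool" where
  "walk M \<equiv> successively (edge M)"

fun cost :: "'a chain \<Rightarrow> 'a list \<Rightarrow> nat" where
  "cost M (x # y # \<omega>) = rate M x y + cost M (y # \<omega>)"
| "cost M _ = 0"

fun path_coeff :: "'a chain \<Rightarrow> 'a list \<Rightarrow> real" where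
  "path_coeff M (x # y # \<omega>) = step_coeff M x y * path_coeff M (y # \<omega>)"
| "path_coeff M _ = 1"

lemma path_prob_single [simp]: "path_prob M \<epsilon> [x] = 1"
  by (simp add: path_prob_def)

lemma path_prob_Cons [simp]:
  "path_prob M \<epsilon> (x # y # \<omega>) = pmf (M \<epsilon> x) y * path_prob M \<epsilon> (y # \<omega>)"
  by (simp add: path_prob_def prod.lessThan_Suc_shift del: prod.lessThan_Suc)

lemma path_prob_nonneg [simp]: "path_prob M \<epsilon> \<omega> \<ge> 0"
  by (simp add: path_prob_def prod_nonneg)

section \<open>Orders of magnitude as eps tends to 0\<close>

lemma eventually_at_right_less: "0 < a \<Longrightarrow> eventually (\<lambda>x. x \<in> {0<..<a}) (at_right (0::real))"
  by (rule eventually_at_rightI) auto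

lemma tendsto_power_at_right_0: "((\<lambda>\<epsilon>::real. \<epsilon> ^ k) \<longlongrightarrow> (if k = 0 then 1 else 0)) (at_right 0)"
proof -
  have "((\<lambda>\<epsilon>::real. \<epsilon> ^ k) \<longlongrightarrow> 0 ^ k) (at_right 0)" by (intro tendsto_intros)
  thus ?thesis by (cases k) auto
qed

text \<open>If \<open>r\<close> were larger, f / eps^q would be f / eps^r times a positive power of
  eps and so tend to 0, against the positivity of its limit.\<close>

lemma is_Theta_power_le:
  assumes "is_Theta f (\<lambda>\<epsilon>. \<epsilon> ^ r)" "is_Theta f (\<lambda>\<epsilon>. \<epsilon> ^ q)"
  shows "r \<le> q"
proof (rule ccontr)
  assume "\<not> r \<le> q"
  then obtain k where k: "r = q + Suc k" by (metis add_Suc_right less_imp_Suc_add not_le)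
  obtain a b where a: "a > 0" "((\<lambda>\<epsilon>. f \<epsilon> / \<epsilon> ^ r) \<longlongrightarrow> a) (at_right 0)"
    and b: "b > 0" "((\<lambda>\<epsilon>. f \<epsilon> / \<epsilon> ^ q) \<longlongrightarrow> b) (at_right 0)"
    using assms unfolding is_Theta_def by blast
  have "((\<lambda>\<epsilon>. f \<epsilon> / \<epsilon> ^ r * \<epsilon> ^ Suc k) \<longlongrightarrow> a * 0) (at_right 0)"
    using tendsto_mult[OF a(2) tendsto_power_at_right_0[of "Suc k"]] by simp
  moreover have "eventually (\<lambda>\<epsilon>::real. f \<epsilon> / \<epsilon> ^ r * \<epsilon> ^ Suc k = f \<epsilon> / \<epsilon> ^ q) (at_right 0)"
    using eventually_at_right_less[OF zero_less_one] by eventually_elim (simp add: k power_add field_simps)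
  ultimately have "((\<lambda>\<epsilon>. f \<epsilon> / \<epsilon> ^ q) \<longlongrightarrow> 0) (at_right 0)"
    by (simp add: tendsto_cong)
  from tendsto_unique[OF _ b(2) this] b(1) show False by simp
qed

lemma is_Theta_power_unique:
  "is_Theta f (\<lambda>\<epsilon>. \<epsilon> ^ r) \<Longrightarrow> is_Theta f (\<lambda>\<epsilon>. \<epsilon> ^ q) \<Longrightarrow> r = q"
  by (intro order_antisym is_Theta_power_le)

lemma is_Theta_not_eventually_0:
  assumes "is_Theta f h" shows "\<not> eventually (\<lambda>\<epsilon>. f \<epsilon> = 0) (at_right 0)"
proof
  assume ev: "eventually (\<lambda>\<epsilon>. f \<epsilon> = 0) (at_right 0)"
  obtain a where a: "a > 0" "((\<lambda>\<epsilon>. f \<epsilon> / h \<epsilon>) \<longlongrightarrow> a) (at_right 0)"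
    using assms unfolding is_Theta_def by blast
  have "eventually (\<lambda>\<epsilon>. f \<epsilon> / h \<epsilon> = 0) (at_right 0)" using ev by eventually_elim simp
  hence "((\<lambda>\<epsilon>. f \<epsilon> / h \<epsilon>) \<longlongrightarrow> 0) (at_right 0)" by (simp add: tendsto_eventually)
  from tendsto_unique[OF _ a(2) this] a(1) show False by simp
qed

section \<open>Recursive structure of paths and costs\<close>

lemma paths_between_single [simp]: "[x] \<in> paths_between g t y z \<longleftrightarrow> x = y \<and> x = z"
  by (auto simp: paths_between_def)

lemma Nil_paths_between [simp]: "[] \<notin> paths_between g t y z"
  by (auto simp: paths_between_def)

lemma paths_between_Cons [simp]:
  "x # y # \<omega> \<in> paths_between g t u z \<longleftrightarrow>
     u = x \<and> x \<notin> {t, g} \<and> y # \<omega> \<in> paths_between g t y z"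
  by (auto simp: paths_between_def less_Suc_eq_0_disj)

lemma paths_between_snoc:
  "\<omega> \<in> paths_between g t u x \<Longrightarrow> x \<notin> {t, g} \<Longrightarrow> \<omega> @ [z] \<in> paths_between g t u z"
  by (induction \<omega> arbitrary: u rule: induct_list012) auto

lemma Phi_cases:
  assumes "\<omega> \<in> Phi g t x"
  obtains "x = g" "\<omega> = [g]"
  | y \<omega>' where "x \<notin> {t, g}" "\<omega> = x # y # \<omega>'" "y # \<omega>' \<in> Phi g t y"
proof (cases \<omega> rule: remdups_adj.cases)
  case 1 with assms show ?thesis by (simp add: Phi_def)
next
  case (2 u) with assms that(1) show ?thesis by (auto simp: Phi_def)
next
  case (3 u y \<omega>') with assms that(2) show ?thesis by (auto simp: Phi_def)
qed

text \<open>A path to \<open>g\<close> arises from \<open>[g]\<close> by prepending states outside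
  \<open>{t, g}\<close>. Nearly all arguments about single paths are inductions of this form, with
  an invariant on the current state.\<close>

lemma Phi_induct [consumes 1, case_names goal step]:
  assumes "\<omega> \<in> Phi g t x" "P g [g]"
    and "\<And>x y \<omega>. x \<notin> {t, g} \<Longrightarrow> y # \<omega> \<in> Phi g t y \<Longrightarrow> P y (y # \<omega>) \<Longrightarrow> P x (x # y # \<omega>)"
  shows "P x \<omega>"
  using assms(1)
proof (induction \<omega> arbitrary: x)
  case Nil thus ?case by (simp add: Phi_def)
next
  case (Cons u \<omega>)
  from Cons.prems show ?case
    by (cases rule: Phi_cases) (use assms Cons.IH in auto)
qed

lemma cost_snoc: "\<omega> \<noteq> [] \<Longrightarrow> cost M (\<omega> @ [z]) = cost M \<omega> + rate M (last \<omega>) z"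
  by (induction M \<omega> rule: cost.induct) auto

lemma walk_snoc: "\<omega> \<noteq> [] \<Longrightarrow> walk M (\<omega> @ [z]) \<longleftrightarrow> walk M \<omega> \<and> edge M (last \<omega>) z"
  by (auto simp: successively_append_iff)

lemma step_cong:
  assumes "\<And>\<epsilon>. M \<epsilon> x = M' \<epsilon> x"
  shows "edge M x = edge M' x" "rate M x = rate M' x" "step_coeff M x = step_coeff M' x"
  using assms by (simp_all add: edge_def rate_def step_coeff_def fun_eq_iff)

lemma path_cong:
  assumes "\<And>\<epsilon> x. x \<in> set \<omega> \<Longrightarrow> M \<epsilon> x = M' \<epsilon> x"
  shows "walk M \<omega> = walk M' \<omega>" "cost M \<omega> = cost M' \<omega>" "path_coeff M \<omega> = path_coeff M' \<omega>"
    "path_prob M \<epsilon> \<omega> = path_prob M' \<epsilon> \<omega>"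
proof -
  have "walk M \<omega> = walk M' \<omega> \<and> cost M \<omega> = cost M' \<omega> \<and> path_coeff M \<omega> = path_coeff M' \<omega> \<and>
      path_prob M \<epsilon> \<omega> = path_prob M' \<epsilon> \<omega>"
    using assms
  proof (induction \<omega> rule: induct_list012)
    case (3 x y \<omega>)
    then have "M \<epsilon> x = M' \<epsilon> x" for \<epsilon> by simp
    note step = step_cong[of M x M', OF this] this
    show ?case using "3.IH"(2) "3.prems" step by simp
  qed (simp_all add: path_prob_def)
  then show "walk M \<omega> = walk M' \<omega>" "cost M \<omega> = cost M' \<omega>" "path_coeff M \<omega> = path_coeff M' \<omega>"
    "path_prob M \<epsilon> \<omega> = path_prob M' \<epsilon> \<omega>" by auto
qed

text \<open>Separate from the standing assumptions because it is interpreted twice, for the original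
  chain and for the modified one.\<close>

locale graded_chain =
  fixes M :: "'a chain" and \<epsilon>\<^sub>0 :: real
  assumes eps0: "\<epsilon>\<^sub>0 > 0"
    and rates: "\<And>x z. (\<forall>\<epsilon>\<in>{0<..<\<epsilon>\<^sub>0}. pmf (M \<epsilon> x) z = 0) \<or>
                  ((\<forall>\<epsilon>\<in>{0<..<\<epsilon>\<^sub>0}. pmf (M \<epsilon> x) z > 0) \<and>
                   (\<exists>r::nat. is_Theta (\<lambda>\<epsilon>. pmf (M \<epsilon> x) z) (\<lambda>\<epsilon>. \<epsilon> ^ r)))"
begin

lemma eventually_small: "eventually (\<lambda>\<epsilon>. \<epsilon> \<in> {0<..<\<epsilon>\<^sub>0}) (at_right 0)"
  using eps0 by (rule eventually_at_right_less)

text \<open>By the dichotomy in \<open>rates\<close>, positivity at one small parameter is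
  positivity at all of them.\<close>

lemma edge_iff: "\<epsilon> \<in> {0<..<\<epsilon>\<^sub>0} \<Longrightarrow> edge M x z \<longleftrightarrow> pmf (M \<epsilon> x) z > 0"
proof (rule iffI)
  assume "edge M x z" and e: "\<epsilon> \<in> {0<..<\<epsilon>\<^sub>0}"
  then have "\<exists>\<delta>\<in>{0<..<\<epsilon>\<^sub>0}. pmf (M \<delta> x) z > 0"
    using eventually_happens[OF eventually_conj[OF _ eventually_small]]
    unfolding edge_def by fastforce
  then show "pmf (M \<epsilon> x) z > 0" using rates[of x z] e by force
next
  assume "pmf (M \<epsilon> x) z > 0" and e: "\<epsilon> \<in> {0<..<\<epsilon>\<^sub>0}"
  then have "\<forall>\<epsilon>\<in>{0<..<\<epsilon>\<^sub>0}. pmf (M \<epsilon> x) z > 0" using rates[of x z] by force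
  then show "edge M x z" unfolding edge_def
    using eventually_small by (auto elim: eventually_mono)
qed

lemma no_edge: "\<epsilon> \<in> {0<..<\<epsilon>\<^sub>0} \<Longrightarrow> \<not> edge M x z \<Longrightarrow> pmf (M \<epsilon> x) z = 0"
  using edge_iff[of \<epsilon> x z] pmf_nonneg[of "M \<epsilon> x" z] by linarith

lemma step_limit:
  assumes "edge M x z"
  shows "((\<lambda>\<epsilon>. pmf (M \<epsilon> x) z / \<epsilon> ^ rate M x z) \<longlongrightarrow> step_coeff M x z) (at_right 0)"
    and "step_coeff M x z > 0"
proof -
  have "\<exists>\<epsilon>. \<epsilon> \<in> {0<..<\<epsilon>\<^sub>0}" using eventually_happens[OF eventually_small] by auto
  then obtain r where "is_Theta (\<lambda>\<epsilon>. pmf (M \<epsilon> x) z) (\<lambda>\<epsilon>. \<epsilon> ^ r)"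
    using assms rates[of x z] edge_iff by fastforce
  then have "is_Theta (\<lambda>\<epsilon>. pmf (M \<epsilon> x) z) (\<lambda>\<epsilon>. \<epsilon> ^ rate M x z)"
    unfolding rate_def by (rule someI)
  then obtain c where c: "c > 0" "((\<lambda>\<epsilon>. pmf (M \<epsilon> x) z / \<epsilon> ^ rate M x z) \<longlongrightarrow> c) (at_right 0)"
    unfolding is_Theta_def by blast
  then have "step_coeff M x z = c" unfolding step_coeff_def by (intro tendsto_Lim) auto
  with c show "((\<lambda>\<epsilon>. pmf (M \<epsilon> x) z / \<epsilon> ^ rate M x z) \<longlongrightarrow> step_coeff M x z) (at_right 0)"
    "step_coeff M x z > 0" by simp_all
qed

lemma path_limit:
  assumes "walk M \<omega>"
  shows "((\<lambda>\<epsilon>. path_prob M \<epsilon> \<omega> / \<epsilon> ^ cost M \<omega>) \<longlongrightarrow> path_coeff M \<omega>) (at_right 0)"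
    and "path_coeff M \<omega> > 0"
  using assms
proof (induction \<omega> rule: induct_list012)
  case (3 x y \<omega>)
  { case 1
    have "((\<lambda>\<epsilon>. (pmf (M \<epsilon> x) y / \<epsilon> ^ rate M x y) *
        (path_prob M \<epsilon> (y # \<omega>) / \<epsilon> ^ cost M (y # \<omega>)))
        \<longlongrightarrow> step_coeff M x y * path_coeff M (y # \<omega>)) (at_right 0)"
      using 1 3 by (intro tendsto_mult step_limit) auto
    then show ?case by (simp add: power_add) }
  { case 2 then show ?case using 3 step_limit(2)[of x y] by auto }
qed (simp_all add: path_prob_def)

lemma walk_iff: "\<epsilon> \<in> {0<..<\<epsilon>\<^sub>0} \<Longrightarrow> walk M \<omega> \<longleftrightarrow> path_prob M \<epsilon> \<omega> > 0"
  by (induction \<omega> rule: induct_list012)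
     (auto simp: edge_iff zero_less_mult_iff path_prob_def[of _ _ "[]"] less_le)

text \<open>The dictionary between asymptotics and combinatorics: a walk has exact order
  \<open>cost\<close>, which is unique, and any other list has probability 0 for all small
  parameters, which is not of the order of any power.\<close>

lemma is_Theta_path_iff:
  "is_Theta (\<lambda>\<epsilon>. path_prob M \<epsilon> \<omega>) (\<lambda>\<epsilon>. \<epsilon> ^ r) \<longleftrightarrow> walk M \<omega> \<and> cost M \<omega> = r"
proof (cases "walk M \<omega>")
  case True
  then have "is_Theta (\<lambda>\<epsilon>. path_prob M \<epsilon> \<omega>) (\<lambda>\<epsilon>. \<epsilon> ^ cost M \<omega>)"
    unfolding is_Theta_def using path_limit by blast
  then show ?thesis using True is_Theta_power_unique by blast
next
  case False
  have "eventually (\<lambda>\<epsilon>. path_prob M \<epsilon> \<omega> = 0) (at_right 0)"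
    using eventually_small
    by eventually_elim (use False walk_iff in \<open>metis path_prob_nonneg order_le_less\<close>)
  then show ?thesis using False is_Theta_not_eventually_0 by blast
qed

lemma sum_path_limit:
  assumes "finite X" "\<And>\<omega>. \<omega> \<in> X \<Longrightarrow> walk M \<omega> \<and> k \<le> cost M \<omega>"
  shows "((\<lambda>\<epsilon>. (\<Sum>\<omega>\<in>X. path_prob M \<epsilon> \<omega>) / \<epsilon> ^ k)
           \<longlongrightarrow> (\<Sum>\<omega>\<in>{\<omega> \<in> X. cost M \<omega> = k}. path_coeff M \<omega>)) (at_right 0)"
proof -
  have "((\<lambda>\<epsilon>. path_prob M \<epsilon> \<omega> / \<epsilon> ^ k) \<longlongrightarrow> (if cost M \<omega> = k then path_coeff M \<omega> else 0))
      (at_right 0)" if w: "\<omega> \<in> X" for \<omega>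
  proof -
    \<comment> \<open>The surplus order \<open>e\<close> remains as a factor eps^e, which removes
      the path from the limit unless \<open>e = 0\<close>.\<close>
    obtain e where e: "cost M \<omega> = k + e" using assms(2)[OF w] le_iff_add by blast
    have "((\<lambda>\<epsilon>. path_prob M \<epsilon> \<omega> / \<epsilon> ^ cost M \<omega> * \<epsilon> ^ e)
        \<longlongrightarrow> path_coeff M \<omega> * (if e = 0 then 1 else 0)) (at_right 0)"
      using assms(2)[OF w] by (intro tendsto_mult path_limit tendsto_power_at_right_0) auto
    moreover have "eventually (\<lambda>\<epsilon>. path_prob M \<epsilon> \<omega> / \<epsilon> ^ cost M \<omega> * \<epsilon> ^ e = path_prob M \<epsilon> \<omega> / \<epsilon> ^ k)
        (at_right 0)"
      using eventually_small by eventually_elim (simp add: e power_add)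
    ultimately have "((\<lambda>\<epsilon>. path_prob M \<epsilon> \<omega> / \<epsilon> ^ k)
        \<longlongrightarrow> path_coeff M \<omega> * (if e = 0 then 1 else 0)) (at_right 0)"
      by (rule Lim_transform_eventually)
    then show ?thesis by (cases "e = 0") (simp_all add: e)
  qed
  then have "((\<lambda>\<epsilon>. \<Sum>\<omega>\<in>X. path_prob M \<epsilon> \<omega> / \<epsilon> ^ k)
      \<longlongrightarrow> (\<Sum>\<omega>\<in>X. if cost M \<omega> = k then path_coeff M \<omega> else 0)) (at_right 0)"
    by (rule tendsto_sum)
  then show ?thesis using assms(1) by (simp add: sum_divide_distrib sum.inter_filter)
qed

section \<open>Distances as minimal costs of walks\<close>

lemma dis_eq: "dis M g t x z = Inf {enat (cost M \<omega>) | \<omega>. \<omega> \<in> paths_between g t x z \<and> walk M \<omega>}"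
  unfolding dis_def is_Theta_path_iff by (rule arg_cong[of _ _ Inf]) auto

lemma dis_le: "\<omega> \<in> paths_between g t x z \<Longrightarrow> walk M \<omega> \<Longrightarrow> dis M g t x z \<le> enat (cost M \<omega>)"
  unfolding dis_eq by (rule Inf_lower) blast

lemma dis_attained:
  assumes "dis M g t x z = enat k"
  obtains \<omega> where "\<omega> \<in> paths_between g t x z" "walk M \<omega>" "cost M \<omega> = k"
proof -
  let ?X = "{enat (cost M \<omega>) | \<omega>. \<omega> \<in> paths_between g t x z \<and> walk M \<omega>}"
  have "Inf ?X = enat k" using assms by (simp add: dis_eq)
  \<comment> \<open>The infimum of the empty set is \<infinity>, so a finite value needs a path; as
    \<open>enat\<close> is well-ordered, the infimum is then a minimum.\<close>
  moreover from this have "?X \<noteq> {}" by (metis Inf_empty enat.distinct(1) top_enat_def)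
  then obtain e where "e \<in> ?X" by blast
  from wellorder_InfI[of e ?X, OF this] have "Inf ?X \<in> ?X" .
  ultimately have "enat k \<in> ?X" by simp
  then show ?thesis using that by auto
qed

text \<open>Triangle inequality for one step. The state \<open>x\<close> becomes an interior point
  of the longer path, so it must avoid \<open>t\<close> and \<open>g\<close>.\<close>

lemma dis_snoc:
  assumes "dis M g t u x \<le> enat j" "x \<notin> {t, g}" "edge M x z"
  shows "dis M g t u z \<le> enat (j + rate M x z)"
proof -
  obtain k where k: "dis M g t u x = enat k" "k \<le> j" using assms(1) by (cases "dis M g t u x") auto
  then obtain \<omega> where w: "\<omega> \<in> paths_between g t u x" "walk M \<omega>" "cost M \<omega> = k"
    using dis_attained by blast
  then have "\<omega> \<noteq> []" "last \<omega> = x" by (auto simp: paths_between_def)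
  then have "dis M g t u z \<le> enat (k + rate M x z)"
    using dis_le[OF paths_between_snoc[OF w(1) assms(2)], of z] w assms
    by (simp add: walk_snoc cost_snoc)
  also have "\<dots> \<le> enat (j + rate M x z)" using k by simp
  finally show ?thesis .
qed

lemma dis_Cons:
  assumes "dis M g t y z = enat j" "x \<notin> {t, g}" "edge M x y"
  shows "dis M g t x z \<le> enat (rate M x y + j)"
proof -
  obtain \<omega> where w: "\<omega> \<in> paths_between g t y z" "walk M \<omega>" "cost M \<omega> = j"
    using dis_attained[OF assms(1)] by blast
  then obtain \<omega>' where "\<omega> = y # \<omega>'" by (cases \<omega>) (auto simp: paths_between_def)
  then show ?thesis using w assms dis_le[of "x # \<omega>" g t x z] by auto
qed

end

section \<open>The excess cost of paths to the goal\<close>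

text \<open>Truncation by length turns estimates of sums over the infinite set of paths into
  inductions on \<open>n\<close>; monotone convergence removes it in
  \<open>nn_integral_Phi_le\<close>.\<close>

definition Phi_upto :: "'a \<Rightarrow> 'a \<Rightarrow> nat \<Rightarrow> 'a \<Rightarrow> 'a list set" where
  "Phi_upto g t n x = {\<omega> \<in> Phi g t x. length \<omega> \<le> n}"

lemma Phi_goal [simp]: "Phi g t g = {[g]}"
proof
  show "Phi g t g \<subseteq> {[g]}" by (auto elim: Phi_cases)
qed (simp add: Phi_def)

lemma Phi_taboo: "t \<noteq> g \<Longrightarrow> Phi g t t = {}"
  by (auto elim: Phi_cases)

lemma Phi_hd: "\<omega> \<in> Phi g t x \<Longrightarrow> hd \<omega> = x \<and> \<omega> \<noteq> []"
  by (auto elim: Phi_cases)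

lemma Phi_Cons: "x \<notin> {t, g} \<Longrightarrow> \<omega> \<in> Phi g t z \<Longrightarrow> x # \<omega> \<in> Phi g t x"
  by (erule Phi_cases) (auto simp: Phi_def)

lemma nn_integral_Phi_upto_Suc:
  fixes F :: "'a list \<Rightarrow> ennreal"
  assumes "x \<notin> {t, g}"
  shows "(\<integral>\<^sup>+\<omega>. F \<omega> \<partial>count_space (Phi_upto g t (Suc n) x)) =
    (\<integral>\<^sup>+z. (\<integral>\<^sup>+\<omega>. F (x # \<omega>) \<partial>count_space (Phi_upto g t n z)) \<partial>count_space UNIV)"
proof -
  let ?U = "\<Union>z. Phi_upto g t n z"
  have "Phi_upto g t (Suc n) x \<subseteq> (#) x ` ?U"
  proof
    fix \<omega> assume "\<omega> \<in> Phi_upto g t (Suc n) x"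
    then have "\<omega> \<in> Phi g t x" "length \<omega> \<le> Suc n" by (auto simp: Phi_upto_def)
    then show "\<omega> \<in> (#) x ` ?U"
      by (cases rule: Phi_cases) (use assms in \<open>force simp: Phi_upto_def\<close>)+
  qed
  moreover have "(#) x ` ?U \<subseteq> Phi_upto g t (Suc n) x"
    using Phi_Cons[OF assms] by (auto simp: Phi_upto_def)
  ultimately have "Phi_upto g t (Suc n) x = (#) x ` ?U" ..
  then have "(\<integral>\<^sup>+\<omega>. F \<omega> \<partial>count_space (Phi_upto g t (Suc n) x)) =
      (\<integral>\<^sup>+\<omega>. F (x # \<omega>) \<partial>count_space ?U)"
    by (simp add: nn_integral_bij_count_space[OF bij_betw_imageI[OF _ refl], symmetric])
  also have "\<dots> = (\<integral>\<^sup>+\<omega>. F (x # \<omega>) * indicator ?U \<omega> \<partial>count_space UNIV)"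
    by (simp add: nn_integral_count_space_indicator)
  also have "\<dots> = (\<integral>\<^sup>+\<omega>. (\<integral>\<^sup>+z. F (x # \<omega>) * indicator (Phi_upto g t n z) \<omega> \<partial>count_space UNIV)
      \<partial>count_space UNIV)"
  proof (rule nn_integral_cong)
    fix \<omega>
    \<comment> \<open>A path belongs to \<open>Phi_upto g t n z\<close> for the single state
      \<open>z = hd \<omega>\<close>, so the sum over \<open>z\<close> has one nonzero term, and the
      two sums can be exchanged by Tonelli.\<close>
    have "indicator (Phi_upto g t n z) \<omega> =
        (indicator {hd \<omega>} z * indicator ?U \<omega> :: ennreal)" for z
      by (auto simp: indicator_def Phi_upto_def dest: Phi_hd)
    then have "(\<integral>\<^sup>+z. F (x # \<omega>) * indicator (Phi_upto g t n z) \<omega> \<partial>count_space UNIV) =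
        (\<integral>\<^sup>+z. (F (x # \<omega>) * indicator ?U \<omega>) * indicator {hd \<omega>} z \<partial>count_space UNIV)"
      by (simp add: mult_ac)
    then show "F (x # \<omega>) * indicator ?U \<omega> =
        (\<integral>\<^sup>+z. F (x # \<omega>) * indicator (Phi_upto g t n z) \<omega> \<partial>count_space UNIV)"
      by (simp add: nn_integral_cmult)
  qed
  also have "\<dots> = (\<integral>\<^sup>+z. (\<integral>\<^sup>+\<omega>. F (x # \<omega>) * indicator (Phi_upto g t n z) \<omega> \<partial>count_space UNIV)
      \<partial>count_space UNIV)"
    using nn_integral_fst_count_space[of "\<lambda>(\<omega>, z). F (x # \<omega>) * indicator (Phi_upto g t n z) \<omega>"]
      nn_integral_snd_count_space[of "\<lambda>(\<omega>, z). F (x # \<omega>) * indicator (Phi_upto g t n z) \<omega>"]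
    by simp
  finally show ?thesis by (simp add: nn_integral_count_space_indicator)
qed

lemma nn_integral_Phi_le:
  assumes "\<And>n. (\<integral>\<^sup>+\<omega>. F \<omega> \<partial>count_space (Phi_upto g t n x)) \<le> c"
  shows "(\<integral>\<^sup>+\<omega>. F \<omega> \<partial>count_space (Phi g t x)) \<le> c"
proof -
  have "(\<integral>\<^sup>+\<omega>. F \<omega> \<partial>count_space (Phi g t x)) =
      (\<integral>\<^sup>+\<omega>. F \<omega> * indicator (Phi g t x) \<omega> \<partial>count_space UNIV)"
    by (simp add: nn_integral_count_space_indicator)
  also have "\<dots> = (\<integral>\<^sup>+\<omega>. (SUP n. F \<omega> * indicator (Phi_upto g t n x) \<omega>) \<partial>count_space UNIV)"
  proof (rule nn_integral_cong)
    fix \<omega>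
    have "(SUP n. F \<omega> * indicator (Phi_upto g t n x) \<omega>) = F \<omega> * indicator (Phi g t x) \<omega>"
    proof (rule antisym)
      show "(SUP n. F \<omega> * indicator (Phi_upto g t n x) \<omega>) \<le> F \<omega> * indicator (Phi g t x) \<omega>"
        by (intro SUP_least mult_left_mono) (auto simp: Phi_upto_def indicator_def)
      show "F \<omega> * indicator (Phi g t x) \<omega> \<le> (SUP n. F \<omega> * indicator (Phi_upto g t n x) \<omega>)"
        by (rule SUP_upper2[of "length \<omega>"]) (auto simp: Phi_upto_def indicator_def)
    qed
    then show "F \<omega> * indicator (Phi g t x) \<omega> = (SUP n. F \<omega> * indicator (Phi_upto g t n x) \<omega>)" ..
  qed
  also have "\<dots> = (SUP n. \<integral>\<^sup>+\<omega>. F \<omega> * indicator (Phi_upto g t n x) \<omega> \<partial>count_space UNIV)"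
    by (intro nn_integral_monotone_convergence_SUP)
       (auto simp: incseq_def le_fun_def Phi_upto_def indicator_def)
  also have "\<dots> \<le> c"
    using assms by (intro SUP_least) (simp add: nn_integral_count_space_indicator)
  finally show ?thesis .
qed

lemma Phi_upto_0 [simp]: "Phi_upto g t 0 x = {}"
  by (auto simp: Phi_upto_def dest: Phi_hd)

text \<open>First-step analysis for an arbitrary chain. This is the only control over what happens
  after the exit from \<open>\<Lambda>\<close>.\<close>

lemma nn_integral_path_prob_Phi_upto_le:
  "(\<integral>\<^sup>+\<omega>. ennreal (path_prob M \<epsilon> \<omega>) \<partial>count_space (Phi_upto g t n x)) \<le> 1"
proof (induction n arbitrary: x)
  case 0 then show ?case by (simp add: nn_integral_count_space_finite)
next
  case (Suc n)
  consider "x = g" | "x = t" "x \<noteq> g" | "x \<notin> {t, g}" by auto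
  then show ?case
  proof cases
    case 1
    then have "Phi_upto g t (Suc n) x = {[g]}" by (auto simp: Phi_upto_def)
    then show ?thesis by (simp add: nn_integral_count_space_finite)
  next
    case 2
    then have "Phi_upto g t (Suc n) x = {}" by (auto simp: Phi_upto_def Phi_taboo)
    then show ?thesis by (simp add: nn_integral_count_space_finite)
  next
    case 3
    have "(\<integral>\<^sup>+\<omega>. ennreal (path_prob M \<epsilon> \<omega>) \<partial>count_space (Phi_upto g t (Suc n) x)) =
      (\<integral>\<^sup>+z. (\<integral>\<^sup>+\<omega>. ennreal (pmf (M \<epsilon> x) z) * ennreal (path_prob M \<epsilon> \<omega>)
        \<partial>count_space (Phi_upto g t n z)) \<partial>count_space UNIV)"
      unfolding nn_integral_Phi_upto_Suc[OF 3]
    proof (intro nn_integral_cong)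
      fix z \<omega> assume "\<omega> \<in> space (count_space (Phi_upto g t n z))"
      then have "\<omega> \<in> Phi g t z" by (simp add: Phi_upto_def)
      then show "ennreal (path_prob M \<epsilon> (x # \<omega>)) = ennreal (pmf (M \<epsilon> x) z) * ennreal (path_prob M \<epsilon> \<omega>)"
        by (cases rule: Phi_cases) (auto simp: ennreal_mult)
    qed
    also have "\<dots> \<le> (\<integral>\<^sup>+z. ennreal (pmf (M \<epsilon> x) z) * 1 \<partial>count_space UNIV)"
      by (intro nn_integral_mono) (simp only: nn_integral_cmult borel_measurable_count_space, intro mult_left_mono Suc zero_le)
    also have "\<dots> = 1" by (simp add: nn_integral_pmf emeasure_pmf)
    finally show ?thesis .
  qed
qed

text \<open>
  On a path to \<open>g\<close>, \<open>weight\<close> multiplies \<open>\<rho>\<close> over the states visited before the first exit from \<open>L\<close>.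
  With \<open>L = Lam - {g}\<close> and \<open>\<rho> x\<close> the ratio of $\sum_z \bar p_{xz} v(z)$ to $v(x)$, the likelihood ratio is
  \<open>v(s)\<close> times the weight.
\<close>

fun weight :: "'a set \<Rightarrow> ('a \<Rightarrow> real) \<Rightarrow> 'a list \<Rightarrow> real" where
  "weight L \<rho> (x # y # \<omega>) = (if x \<in> L then \<rho> x * weight L \<rho> (y # \<omega>) else 1)"
| "weight L \<rho> _ = 1"

text \<open>Only steps that start in \<open>L\<close> are charged, including the one that leaves it:
  beyond the exit there is no uniform bound of probabilities by powers of eps.\<close>

fun exit_cost :: "'a chain \<Rightarrow> 'a set \<Rightarrow> 'a list \<Rightarrow> nat" where
  "exit_cost M L (x # y # \<omega>) = (if x \<in> L then rate M x y + exit_cost M L (y # \<omega>) else 0)"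
| "exit_cost M L _ = 0"

lemma exit_cost_le: "exit_cost M L \<omega> \<le> cost M \<omega>"
  by (induction \<omega> rule: induct_list012) auto

locale rare_event_chain = graded_chain K \<epsilon>\<^sub>0
  for K :: "'a chain" and \<epsilon>\<^sub>0 +
  fixes s g t :: 'a
  assumes finite_Lam: "finite (Lam K s g t)"
    and finite_Gam: "finite (Gam K s g t)"
    and goal_reachable: "dis K g t s g < \<infinity>"
    and no_high_prob_cycle:
      "\<And>\<omega>. length \<omega> \<ge> 2 \<Longrightarrow> last \<omega> = hd \<omega> \<Longrightarrow>
             is_Theta (\<lambda>\<epsilon>. path_prob K \<epsilon> \<omega>) (\<lambda>\<epsilon>. \<epsilon> ^ 0) \<Longrightarrow> set \<omega> = {g} \<or> set \<omega> = {t}"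
begin

abbreviation \<Lambda> :: "'a set" where "\<Lambda> \<equiv> Lam K s g t"
abbreviation \<Gamma> :: "'a set" where "\<Gamma> \<equiv> Gam K s g t"

definition d :: nat where "d = the_enat (dis K g t s g)"

lemma dis_goal: "dis K g t s g = enat d"
  using goal_reachable by (auto simp: d_def)

lemma goal_in_Lam [simp]: "g \<in> \<Lambda>" by (simp add: Lam_def)

lemma Lam_Gam_disjoint: "x \<in> \<Lambda> \<Longrightarrow> x \<notin> \<Gamma>" by (simp add: Gam_def)

lemma edge_Lam: "x \<in> \<Lambda> \<Longrightarrow> edge K x z \<Longrightarrow> z \<in> \<Lambda> \<union> \<Gamma>"
  by (auto simp: Gam_def edge_def)

lemma start_dis: "dis K g t s s = 0"
  using dis_le[of "[s]" g t s s] by (simp add: zero_enat_def[symmetric])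

lemma start_in_Lam [simp]: "s \<in> \<Lambda>"
  by (simp add: Lam_def start_dis)

lemma card_pos: "card (\<Lambda> \<union> \<Gamma>) > 0"
  using finite_Lam finite_Gam by (metis UnI1 card_gt_0_iff empty_iff finite_UnI start_in_Lam)

section \<open>Steps of rate 0 and their rank\<close>

definition free_steps :: "('a \<times> 'a) set" where
  "free_steps = {(x, z). x \<in> \<Lambda> - {t, g} \<and> edge K x z \<and> rate K x z = 0}"

lemma free_steps_trancl_walk:
  assumes "(x, z) \<in> free_steps\<^sup>+"
  shows "\<exists>\<omega>. length \<omega> \<ge> 2 \<and> hd \<omega> = x \<and> last \<omega> = z \<and> walk K \<omega> \<and> cost K \<omega> = 0"
  using assms
proof (induction rule: trancl_induct)
  case (base z)
  then show ?case by (intro exI[of _ "[x, z]"]) (auto simp: free_steps_def)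
next
  case (step y z)
  then obtain \<omega> where w: "length \<omega> \<ge> 2" "hd \<omega> = x" "last \<omega> = y" "walk K \<omega>" "cost K \<omega> = 0"
    by auto
  then have "\<omega> \<noteq> []" by auto
  with w step(2) show ?case
    by (intro exI[of _ "\<omega> @ [z]"]) (auto simp: walk_snoc cost_snoc free_steps_def)
qed

text \<open>A cycle would be a closed walk of cost 0, hence of probability of order 1. The permitted
  loops at \<open>g\<close> and \<open>t\<close> are not built from \<open>free_steps\<close>, whose
  sources avoid both states.\<close>

lemma free_steps_acyclic: "(x, x) \<notin> free_steps\<^sup>+"
proof
  assume x: "(x, x) \<in> free_steps\<^sup>+"
  then obtain \<omega> where w: "length \<omega> \<ge> 2" "hd \<omega> = x" "last \<omega> = x" "walk K \<omega>" "cost K \<omega> = 0"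
    using free_steps_trancl_walk by blast
  then have "set \<omega> = {g} \<or> set \<omega> = {t}"
    using no_high_prob_cycle[of \<omega>] is_Theta_path_iff[of \<omega> 0] by simp
  moreover have "x \<in> set \<omega>" using w by (cases \<omega>) auto
  moreover have "x \<notin> {t, g}" using tranclD[OF x] by (auto simp: free_steps_def)
  ultimately show False by auto
qed

text \<open>
  A rank that drops along the steps of rate 0 inside \<open>Lam\<close>; it exists because there are no
  cycles of high probability.
\<close>

definition height :: "'a \<Rightarrow> nat" where
  "height x = card {z \<in> \<Lambda> \<union> \<Gamma>. (x, z) \<in> free_steps\<^sup>+}"

lemma height_le: "height x \<le> card (\<Lambda> \<union> \<Gamma>)"
  unfolding height_def using finite_Lam finite_Gam by (intro card_mono) auto

text \<open>Whatever is reachable from \<open>z\<close> is reachable from \<open>x\<close>, and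
  \<open>z\<close> itself is reachable from \<open>x\<close> but, by acyclicity, not from
  \<open>z\<close>.\<close>

lemma height_less:
  assumes "(x, z) \<in> free_steps" shows "height z < height x"
proof -
  have "z \<in> \<Lambda> \<union> \<Gamma>" using assms edge_Lam[of x z] by (auto simp: free_steps_def)
  then have "{y \<in> \<Lambda> \<union> \<Gamma>. (z, y) \<in> free_steps\<^sup>+} \<subset> {y \<in> \<Lambda> \<union> \<Gamma>. (x, y) \<in> free_steps\<^sup>+}"
    using assms free_steps_acyclic[of z] by (auto intro: trancl_into_trancl2)
  then show ?thesis
    unfolding height_def using finite_Lam finite_Gam by (intro psubset_card_mono) auto
qed

section \<open>Uniform step bounds and the superharmonic potential\<close>

lemma pmf_bound_ex:
  "\<exists>c\<ge>1. eventually (\<lambda>\<epsilon>. \<forall>x\<in>\<Lambda>. \<forall>z\<in>\<Lambda> \<union> \<Gamma>. edge K x z \<longrightarrow> pmf (K \<epsilon> x) z \<le> c * \<epsilon> ^ rate K x z)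
     (at_right 0)"
proof -
  \<comment> \<open>Any number above all the limits will do. A sum over the finite set of pairs
    exceeds each coefficient, and the leading 1 gives \<open>c \<ge> 1\<close>.\<close>
  define c where "c = 1 + (\<Sum>p\<in>\<Lambda> \<times> (\<Lambda> \<union> \<Gamma>). \<bar>step_coeff K (fst p) (snd p)\<bar> + 1)"
  have "eventually (\<lambda>\<epsilon>. edge K x z \<longrightarrow> pmf (K \<epsilon> x) z \<le> c * \<epsilon> ^ rate K x z) (at_right 0)"
    if xz: "x \<in> \<Lambda>" "z \<in> \<Lambda> \<union> \<Gamma>" for x z
  proof (cases "edge K x z")
    case True
    have "\<bar>step_coeff K x z\<bar> + 1 \<le> (\<Sum>p\<in>\<Lambda> \<times> (\<Lambda> \<union> \<Gamma>). \<bar>step_coeff K (fst p) (snd p)\<bar> + 1)"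
      using member_le_sum[of "(x, z)" "\<Lambda> \<times> (\<Lambda> \<union> \<Gamma>)" "\<lambda>p. \<bar>step_coeff K (fst p) (snd p)\<bar> + 1"]
        xz finite_Lam finite_Gam by simp
    then have "step_coeff K x z < c" unfolding c_def by linarith
    then have "eventually (\<lambda>\<epsilon>. pmf (K \<epsilon> x) z / \<epsilon> ^ rate K x z < c) (at_right 0)"
      by (intro order_tendstoD(2)[OF step_limit(1)[OF True]])
    with eventually_small show ?thesis
      by eventually_elim (auto simp: divide_simps split: if_splits)
  qed simp
  then have "eventually (\<lambda>\<epsilon>. \<forall>x\<in>\<Lambda>. \<forall>z\<in>\<Lambda> \<union> \<Gamma>. edge K x z \<longrightarrow> pmf (K \<epsilon> x) z \<le> c * \<epsilon> ^ rate K x z)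
     (at_right 0)"
    using finite_Lam finite_Gam by (intro eventually_ball_finite ballI) auto
  moreover have "c \<ge> 1" unfolding c_def by (simp add: sum_nonneg)
  ultimately show ?thesis by blast
qed

text \<open>
  The potential \<open>\<beta> ^ height x * (B * \<epsilon>) ^ k\<close>, where \<open>k\<close> is the cost still to be spent, is
  superharmonic: a step of rate 0 lowers the height, which gains a factor \<open>\<beta>\<close>, and a step of
  positive rate gains a factor \<open>B\<close>, which outweighs any increase of the height.  The difference
  \<open>k - rate K x z\<close> is truncated, as no cost remains to be spent after an overshoot.
\<close>

lemma excess_step:
  fixes \<beta> \<epsilon> \<rho> c G :: real
  assumes "x \<in> \<Lambda> - {t, g}" "edge K x z" "\<epsilon> \<in> {0<..<\<epsilon>\<^sub>0}"
    and "c \<ge> 1" "pmf (K \<epsilon> x) z \<le> c * \<epsilon> ^ rate K x z"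
    and "0 \<le> \<rho>" "\<rho> \<le> G" "G \<ge> 1"
    and \<beta>: "\<beta> = G * c * card (\<Lambda> \<union> \<Gamma>)" and B: "B = \<beta> ^ Suc (card (\<Lambda> \<union> \<Gamma>))" "B * \<epsilon> \<le> 1"
  shows "pmf (K \<epsilon> x) z * \<rho> * (\<beta> ^ height z * (B * \<epsilon>) ^ (k - rate K x z))
    \<le> \<beta> ^ height x * (B * \<epsilon>) ^ k / card (\<Lambda> \<union> \<Gamma>)"
proof -
  define N where "N = card (\<Lambda> \<union> \<Gamma>)"
  define r where "r = rate K x z"
  have "N > 0" unfolding N_def by (rule card_pos)
  have "1 * 1 \<le> G * c" using assms by (intro mult_mono) auto
  moreover have "real N \<ge> 1" using \<open>N > 0\<close> by simp
  ultimately have "1 * 1 \<le> (G * c) * real N" by (intro mult_mono) auto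
  then have b1: "\<beta> \<ge> 1" by (simp add: \<beta> N_def)
  have e: "\<epsilon> > 0" using assms by simp
  have B1: "B \<ge> 1" using one_le_power[OF b1] unfolding B .
  \<comment> \<open>The additional factor \<open>\<beta>\<close> on the left pays for
    \<open>G\<close>, for \<open>c\<close> and for the division by the number of states.\<close>
  have key: "\<epsilon> ^ r * (\<beta> ^ Suc (height z) * (B * \<epsilon>) ^ (k - r)) \<le> \<beta> ^ height x * (B * \<epsilon>) ^ k"
  proof (cases "r = 0")
    case True
    then have "height z < height x" using assms by (intro height_less) (auto simp: free_steps_def r_def)
    then have "\<beta> ^ Suc (height z) \<le> \<beta> ^ height x" using b1 by (intro power_increasing) auto
    then show ?thesis using True B1 e by (auto intro!: mult_right_mono)
  next
    case False
    \<comment> \<open>A height is at most the number of states, so the exponent in \<open>B\<close>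
      covers the largest height plus the additional factor \<open>\<beta>\<close>.\<close>
    have "\<beta> ^ Suc (height z) \<le> B"
      unfolding B using b1 height_le[of z] by (intro power_increasing) auto
    also have "B \<le> B ^ r" using B1 False by (intro self_le_power) auto
    finally have "\<epsilon> ^ r * (\<beta> ^ Suc (height z) * (B * \<epsilon>) ^ (k - r))
        \<le> \<epsilon> ^ r * (B ^ r * (B * \<epsilon>) ^ (k - r))"
      using e B1 by (intro mult_left_mono mult_right_mono) auto
    also have "\<dots> = (B * \<epsilon>) ^ (r + (k - r))" by (simp add: power_mult_distrib power_add)
    \<comment> \<open>\<open>r + (k - r) \<ge> k\<close>, strictly after an overshoot; a base of at
      most 1 is what allows lowering the exponent.\<close>
    also have "\<dots> \<le> (B * \<epsilon>) ^ k" using e B1 B by (intro power_decreasing) auto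
    also have "\<dots> \<le> \<beta> ^ height x * (B * \<epsilon>) ^ k"
      using mult_right_mono[OF one_le_power[OF b1], of "(B * \<epsilon>) ^ k" "height x"] e B1 by simp
    finally show ?thesis .
  qed
  have "pmf (K \<epsilon> x) z * \<rho> * (\<beta> ^ height z * (B * \<epsilon>) ^ (k - r))
      \<le> (c * \<epsilon> ^ r) * G * (\<beta> ^ height z * (B * \<epsilon>) ^ (k - r))"
    using assms e B1 b1 by (intro mult_right_mono mult_mono) (auto simp: r_def)
  also have "\<dots> = \<epsilon> ^ r * (\<beta> ^ Suc (height z) * (B * \<epsilon>) ^ (k - r)) / N"
    using \<open>N > 0\<close> by (simp add: \<beta> N_def[symmetric])
  also have "\<dots> \<le> \<beta> ^ height x * (B * \<epsilon>) ^ k / N"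
    using key by (intro divide_right_mono) auto
  finally show ?thesis by (simp add: N_def r_def)
qed

text \<open>Induction on the length bound, where \<open>j\<close> is the cost already spent. From
  \<open>\<Lambda> - {t, g}\<close> there are at most
  \<open>card (\<Lambda> \<union> \<Gamma>)\<close> next states, and by \<open>excess_step\<close>
  each of them uses at most an equal share of the potential.\<close>

lemma excess_bound_upto:
  fixes \<beta> \<epsilon> c G :: real and \<rho> :: "'a \<Rightarrow> real"
  assumes eps: "\<epsilon> \<in> {0<..<\<epsilon>\<^sub>0}"
    and c: "c \<ge> 1" "\<And>x z. x \<in> \<Lambda> \<Longrightarrow> z \<in> \<Lambda> \<union> \<Gamma> \<Longrightarrow> edge K x z \<Longrightarrow> pmf (K \<epsilon> x) z \<le> c * \<epsilon> ^ rate K x z"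
    and \<rho>: "\<And>x. 0 \<le> \<rho> x" "\<And>x. x \<in> \<Lambda> - {t, g} \<Longrightarrow> \<rho> x \<le> G" "G \<ge> 1"
    and \<beta>: "\<beta> = G * c * card (\<Lambda> \<union> \<Gamma>)" and B: "B = \<beta> ^ Suc (card (\<Lambda> \<union> \<Gamma>))" "B * \<epsilon> \<le> 1"
    and "x \<in> \<Lambda> \<union> \<Gamma>"
  shows "(\<integral>\<^sup>+\<omega>. ennreal (path_prob K \<epsilon> \<omega> * weight (\<Lambda> - {g}) \<rho> \<omega>) *
       indicator {\<omega>. D \<le> j + exit_cost K (\<Lambda> - {g}) \<omega>} \<omega> \<partial>count_space (Phi_upto g t n x))
     \<le> ennreal (\<beta> ^ height x * (B * \<epsilon>) ^ (D - j))"
  using assms(10)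
proof (induction n arbitrary: x j)
  case 0 then show ?case by (simp add: nn_integral_count_space_finite)
next
  case (Suc n)
  let ?F = "\<lambda>j \<omega>. ennreal (path_prob K \<epsilon> \<omega> * weight (\<Lambda> - {g}) \<rho> \<omega>) *
       indicator {\<omega>. D \<le> j + exit_cost K (\<Lambda> - {g}) \<omega>} \<omega>"
  let ?U = "\<lambda>x j. \<beta> ^ height x * (B * \<epsilon>) ^ (D - j)"
  note N = card_pos
  have "1 * 1 \<le> G * c" using c \<rho> by (intro mult_mono) auto
  moreover have "real (card (\<Lambda> \<union> \<Gamma>)) \<ge> 1" using N by simp
  ultimately have "1 * 1 \<le> (G * c) * real (card (\<Lambda> \<union> \<Gamma>))" by (intro mult_mono) auto
  then have b1: "\<beta> \<ge> 1" by (simp add: \<beta>)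
  then have U: "?U x j \<ge> 0" for x j using eps by (simp add: B(1))
  \<comment> \<open>No more weight or cost is collected here. If \<open>D \<le> j\<close>, the
    exponent is 0, so the potential is at least 1 and bounds the total probability; otherwise no
    path is counted.\<close>
  have outside: ?case if F: "\<And>\<omega>. \<omega> \<in> Phi_upto g t (Suc n) x \<Longrightarrow> weight (\<Lambda> - {g}) \<rho> \<omega> = 1 \<and> exit_cost K (\<Lambda> - {g}) \<omega> = 0"
  proof -
    have "(\<integral>\<^sup>+\<omega>. ?F j \<omega> \<partial>count_space (Phi_upto g t (Suc n) x)) =
        (\<integral>\<^sup>+\<omega>. ennreal (path_prob K \<epsilon> \<omega>) * (if D \<le> j then 1 else 0) \<partial>count_space (Phi_upto g t (Suc n) x))"
      using F by (intro nn_integral_cong) (auto simp: indicator_def)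
    also have "\<dots> \<le> (if D \<le> j then 1 else 0)"
      using nn_integral_path_prob_Phi_upto_le[where M = K and n = "Suc n" and x = x] by simp
    also have "\<dots> \<le> ennreal (?U x j)"
      using b1 by simp
    finally show ?thesis .
  qed
  consider "x = g" | "x \<noteq> g" "x = t" | "x \<notin> {t, g}" "x \<notin> \<Lambda>" | "x \<in> \<Lambda> - {t, g}" by blast
  then show ?case
  proof cases
    case 1
    then show ?thesis by (intro outside) (auto simp: Phi_upto_def)
  next
    case 2
    then have "Phi_upto g t (Suc n) x = {}" by (auto simp: Phi_upto_def Phi_taboo)
    then show ?thesis by (simp add: nn_integral_count_space_finite)
  next
    case 3
    then show ?thesis by (intro outside) (auto simp: Phi_upto_def elim!: Phi_cases[where x = x])
  next
    case 4
    then have nt: "x \<notin> {t, g}" by simp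
    have "(\<integral>\<^sup>+\<omega>. ?F j \<omega> \<partial>count_space (Phi_upto g t (Suc n) x)) =
      (\<integral>\<^sup>+z. (\<integral>\<^sup>+\<omega>. ennreal (pmf (K \<epsilon> x) z * \<rho> x) * ?F (j + rate K x z) \<omega>
        \<partial>count_space (Phi_upto g t n z)) \<partial>count_space UNIV)"
      unfolding nn_integral_Phi_upto_Suc[OF nt]
    proof (intro nn_integral_cong)
      fix z \<omega> assume "\<omega> \<in> space (count_space (Phi_upto g t n z))"
      then have "\<omega> \<in> Phi g t z" by (simp add: Phi_upto_def)
      then obtain \<omega>' where w: "\<omega> = z # \<omega>'" by (cases \<omega>) (auto dest: Phi_hd)
      have "path_prob K \<epsilon> (x # \<omega>) * weight (\<Lambda> - {g}) \<rho> (x # \<omega>) =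
        (pmf (K \<epsilon> x) z * \<rho> x) * (path_prob K \<epsilon> \<omega> * weight (\<Lambda> - {g}) \<rho> \<omega>)"
        using 4 by (simp add: w)
      then show "?F j (x # \<omega>) = ennreal (pmf (K \<epsilon> x) z * \<rho> x) * ?F (j + rate K x z) \<omega>"
        using 4 \<rho>(1) by (simp add: w ennreal_mult' indicator_def mult.assoc add.assoc mult.left_commute)
    qed
    also have "\<dots> \<le> (\<integral>\<^sup>+z. ennreal (?U x j / card (\<Lambda> \<union> \<Gamma>)) * indicator (\<Lambda> \<union> \<Gamma>) z \<partial>count_space UNIV)"
    proof (intro nn_integral_mono)
      fix z
      let ?I = "\<integral>\<^sup>+\<omega>. ?F (j + rate K x z) \<omega> \<partial>count_space (Phi_upto g t n z)"
      have "ennreal (pmf (K \<epsilon> x) z * \<rho> x) * ?I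
        \<le> ennreal (?U x j / card (\<Lambda> \<union> \<Gamma>)) * indicator (\<Lambda> \<union> \<Gamma>) z"
      proof (cases "edge K x z")
        case True
        then have z: "z \<in> \<Lambda> \<union> \<Gamma>" using 4 edge_Lam by blast
        have "ennreal (pmf (K \<epsilon> x) z * \<rho> x) * ?I
            \<le> ennreal (pmf (K \<epsilon> x) z * \<rho> x) * ennreal (?U z (j + rate K x z))"
          using Suc.IH[OF z] by (intro mult_left_mono) auto
        also have "\<dots> = ennreal (pmf (K \<epsilon> x) z * \<rho> x * ?U z (j + rate K x z))"
          using U \<rho>(1) by (intro ennreal_mult[symmetric]) auto
        also have "\<dots> \<le> ennreal (?U x j / card (\<Lambda> \<union> \<Gamma>))"
          using excess_step[OF 4 True eps c(1) c(2)[OF _ z True] \<rho>(1) \<rho>(2)[OF 4] \<rho>(3) \<beta> B, of "D - j"] 4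
          by (intro ennreal_leI) simp
        finally show ?thesis using z by simp
      qed (use no_edge eps in simp)
      then show "(\<integral>\<^sup>+\<omega>. ennreal (pmf (K \<epsilon> x) z * \<rho> x) * ?F (j + rate K x z) \<omega>
          \<partial>count_space (Phi_upto g t n z)) \<le> ennreal (?U x j / card (\<Lambda> \<union> \<Gamma>)) * indicator (\<Lambda> \<union> \<Gamma>) z"
        by (simp add: nn_integral_cmult)
    qed
    also have "\<dots> = ennreal (?U x j / card (\<Lambda> \<union> \<Gamma>)) * ennreal (card (\<Lambda> \<union> \<Gamma>))"
      using finite_Lam finite_Gam by (simp add: nn_integral_cmult ennreal_of_nat_eq_real_of_nat)
    also have "\<dots> = ennreal (?U x j)"
      using N U by (subst ennreal_mult'[symmetric]) auto
    finally show ?thesis .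
  qed
qed

end

section \<open>The modified chain and the dominant paths\<close>

context rare_event_chain
begin

abbreviation K\<^sub>m :: "'a chain" where "K\<^sub>m \<equiv> mod_chain K s g t"

lemma mod_chain_Gam: "x \<in> \<Gamma> \<Longrightarrow> K\<^sub>m \<epsilon> x = return_pmf g"
  and mod_chain_other: "x \<notin> \<Gamma> \<Longrightarrow> K\<^sub>m \<epsilon> x = K \<epsilon> x"
  by (simp_all add: mod_chain_def)

text \<open>On \<open>\<Gamma>\<close> the modified probabilities are constantly 0 or 1, and 1 has
  order 0; elsewhere the dichotomy is inherited.\<close>

sublocale mod: graded_chain K\<^sub>m \<epsilon>\<^sub>0
proof
  fix x z
  have "is_Theta (\<lambda>\<epsilon>. 1) (\<lambda>\<epsilon>. \<epsilon> ^ 0)"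
    unfolding is_Theta_def by (intro exI[of _ 1]) simp
  then have "x \<in> \<Gamma> \<Longrightarrow> z = g \<Longrightarrow> (\<exists>r::nat. is_Theta (\<lambda>\<epsilon>. pmf (K\<^sub>m \<epsilon> x) z) (\<lambda>\<epsilon>. \<epsilon> ^ r))"
    by (auto simp: mod_chain_Gam simp del: power_0)
  then show "(\<forall>\<epsilon>\<in>{0<..<\<epsilon>\<^sub>0}. pmf (K\<^sub>m \<epsilon> x) z = 0) \<or>
      ((\<forall>\<epsilon>\<in>{0<..<\<epsilon>\<^sub>0}. pmf (K\<^sub>m \<epsilon> x) z > 0) \<and>
       (\<exists>r::nat. is_Theta (\<lambda>\<epsilon>. pmf (K\<^sub>m \<epsilon> x) z) (\<lambda>\<epsilon>. \<epsilon> ^ r)))"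
    using rates[of x z] by (cases "x \<in> \<Gamma>"; cases "z = g") (auto simp: mod_chain_Gam mod_chain_other)
qed (rule eps0)

lemma mod_step:
  assumes "x \<notin> \<Gamma>"
  shows "edge K\<^sub>m x = edge K x" "rate K\<^sub>m x = rate K x"
  using assms by (auto intro!: step_cong mod_chain_other)

lemma mod_edge_Gam: "x \<in> \<Gamma> \<Longrightarrow> edge K\<^sub>m x z \<longleftrightarrow> z = g"
  by (cases "z = g") (auto simp: edge_def mod_chain_Gam)

lemma mod_rate_Gam:
  assumes "x \<in> \<Gamma>" shows "rate K\<^sub>m x g = 0"
proof -
  \<comment> \<open>As \<open>rate\<close> is a choice, its value has to be read off from the
    uniqueness of orders, here for a path of one step.\<close>
  have "is_Theta (\<lambda>\<epsilon>. path_prob K\<^sub>m \<epsilon> [x, g]) (\<lambda>\<epsilon>. \<epsilon> ^ 0)"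
    unfolding is_Theta_def using assms by (intro exI[of _ 1]) (simp add: mod_chain_Gam)
  then show ?thesis unfolding mod.is_Theta_path_iff by simp
qed

lemma mod_path_Lam:
  assumes "set \<omega> \<subseteq> \<Lambda>"
  shows "walk K\<^sub>m \<omega> = walk K \<omega>" "cost K\<^sub>m \<omega> = cost K \<omega>" "path_coeff K\<^sub>m \<omega> = path_coeff K \<omega>"
    "path_prob K\<^sub>m \<epsilon> \<omega> = path_prob K \<epsilon> \<omega>"
  using assms Lam_Gam_disjoint by (auto intro!: path_cong mod_chain_other)

abbreviation dbar :: "'a \<Rightarrow> enat" where "dbar x \<equiv> dis_bar K s g t x g"

lemma dbar_le: "\<omega> \<in> Phi g t x \<Longrightarrow> walk K\<^sub>m \<omega> \<Longrightarrow> dbar x \<le> enat (cost K\<^sub>m \<omega>)"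
  unfolding dis_bar_def Phi_def by (rule mod.dis_le)

lemma dbar_attained:
  assumes "dbar x = enat k"
  obtains \<omega> where "\<omega> \<in> Phi g t x" "walk K\<^sub>m \<omega>" "cost K\<^sub>m \<omega> = k"
  using mod.dis_attained[of g t x g k] assms unfolding dis_bar_def Phi_def by blast

lemma dbar_Cons: "dbar y = enat j \<Longrightarrow> x \<notin> {t, g} \<Longrightarrow> edge K\<^sub>m x y \<Longrightarrow> dbar x \<le> enat (rate K\<^sub>m x y + j)"
  unfolding dis_bar_def by (rule mod.dis_Cons)

lemma Delta_eq: "Delta K s g t x = {\<omega> \<in> Phi g t x. walk K\<^sub>m \<omega> \<and> dbar x = enat (cost K\<^sub>m \<omega>)}"
  unfolding Delta_def mod.is_Theta_path_iff by auto

lemma Phi_Gam: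
  assumes "\<omega> \<in> Phi g t x" "walk K\<^sub>m \<omega>" "x \<in> \<Gamma>" shows "\<omega> = [x, g]"
  using assms(1)
proof (cases rule: Phi_cases)
  case 1 then show ?thesis using assms(3) Lam_Gam_disjoint goal_in_Lam by blast
next
  case (2 y \<omega>')
  then have "y = g" using assms by (simp add: mod_edge_Gam)
  then show ?thesis using 2 by simp
qed

text \<open>The state \<open>t\<close> is excluded because it can lie in \<open>\<Gamma>\<close>,
  while no path to \<open>g\<close> starts there.\<close>

lemma mod_path_Gam:
  assumes "x \<in> \<Gamma>" "x \<noteq> t"
  shows "[x, g] \<in> Phi g t x" "walk K\<^sub>m [x, g]" "cost K\<^sub>m [x, g] = 0" "path_prob K\<^sub>m \<epsilon> [x, g] = 1"
proof -
  have "x \<noteq> g" using assms Lam_Gam_disjoint[of g] by auto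
  then show "[x, g] \<in> Phi g t x" "walk K\<^sub>m [x, g]" "cost K\<^sub>m [x, g] = 0" "path_prob K\<^sub>m \<epsilon> [x, g] = 1"
    using assms by (simp_all add: Phi_def mod_edge_Gam mod_rate_Gam mod_chain_Gam)
qed

lemma dbar_goal: "dbar g = enat 0"
  using dbar_le[of "[g]" g] by (simp add: zero_enat_def[symmetric])

lemma dbar_Gam: "x \<in> \<Gamma> \<Longrightarrow> x \<noteq> t \<Longrightarrow> dbar x = enat 0"
  using dbar_le[of "[x, g]" x] mod_path_Gam[of x] by (simp add: zero_enat_def[symmetric])

text \<open>A walk of the original chain is followed until it leaves \<open>\<Lambda>\<close>; there
  the modified chain jumps to \<open>g\<close>. Hence \<open>v\<close> is eventually positive at all
  states that such a walk visits up to its exit.\<close>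

lemma dbar_finite:
  assumes "\<omega> \<in> Phi g t x" "walk K \<omega>" "x \<in> \<Lambda> \<union> \<Gamma>"
  shows "dbar x \<noteq> \<infinity>"
  using assms
proof (induction rule: Phi_induct)
  case goal then show ?case by (simp add: dbar_goal)
next
  case (step x y \<omega>)
  show ?case
  proof (cases "x \<in> \<Lambda>")
    case True
    then have "dbar y \<noteq> \<infinity>" using step edge_Lam by auto
    then obtain j where "dbar y = enat j" by auto
    moreover have "edge K\<^sub>m x y" using step True Lam_Gam_disjoint by (simp add: mod_step)
    ultimately show ?thesis using dbar_Cons[of y j x] step(1) by (cases "dbar x") auto
  next
    case False
    then show ?thesis using step by (simp add: dbar_Gam)
  qed
qed

text \<open>A free step lowers the height, and a step of positive rate raises it by at most the
  number of states, so each unit of cost pays for that rise and for the step itself. The 2 is the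
  length of the shortcut \<open>[x, g]\<close> from \<open>\<Gamma>\<close>. Bounded cost thus
  leaves finitely many paths.\<close>

lemma Phi_walk_Lam_Gam:
  assumes "\<omega> \<in> Phi g t x" "walk K\<^sub>m \<omega>" "x \<in> \<Lambda> \<union> \<Gamma>"
  shows "set \<omega> \<subseteq> \<Lambda> \<union> \<Gamma> \<and> length \<omega> \<le> 2 + height x + Suc (card (\<Lambda> \<union> \<Gamma>)) * cost K\<^sub>m \<omega>"
  using assms
proof (induction rule: Phi_induct)
  case goal then show ?case by simp
next
  case (step x y \<omega>)
  show ?case
  proof (cases "x \<in> \<Lambda>")
    case True
    then have e: "edge K x y" and r: "rate K\<^sub>m x y = rate K x y"
      using step Lam_Gam_disjoint by (auto simp: mod_step)
    have IH: "set (y # \<omega>) \<subseteq> \<Lambda> \<union> \<Gamma>"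
        "length (y # \<omega>) \<le> 2 + height y + Suc (card (\<Lambda> \<union> \<Gamma>)) * cost K\<^sub>m (y # \<omega>)"
      using step.IH step.prems edge_Lam[OF True e] by auto
    have "Suc (height y) \<le> height x + Suc (card (\<Lambda> \<union> \<Gamma>)) * rate K x y"
    proof (cases "rate K x y")
      case 0
      then have "(x, y) \<in> free_steps" using step True e by (auto simp: free_steps_def)
      then show ?thesis using height_less[of x y] by simp
    next
      case (Suc n)
      then show ?thesis using height_le[of y] by simp
    qed
    then show ?thesis using IH step.prems True by (simp add: r algebra_simps)
  next
    case False
    then have "x \<in> \<Gamma>" using step by auto
    then have "y = g" using step by (simp add: mod_edge_Gam)
    then have "\<omega> = []" using step by auto
    then show ?thesis using \<open>x \<in> \<Gamma>\<close> \<open>y = g\<close> by simp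
  qed
qed

lemma finite_Delta:
  assumes "x \<in> \<Lambda> \<union> \<Gamma>" shows "finite (Delta K s g t x)"
proof (cases "dbar x")
  case (enat k)
  let ?n = "2 + height x + Suc (card (\<Lambda> \<union> \<Gamma>)) * k"
  have "Delta K s g t x \<subseteq> {\<omega>. set \<omega> \<subseteq> \<Lambda> \<union> \<Gamma> \<and> length \<omega> \<le> ?n}"
    using Phi_walk_Lam_Gam assms enat by (fastforce simp: Delta_eq)
  then show ?thesis using finite_lists_length_le finite_Lam finite_Gam finite_subset by blast
qed (simp add: Delta_eq)

text \<open>Invariant: \<open>j\<close> bounds the distance from \<open>s\<close> to the current
  state, and with the remaining cost it stays within \<open>d\<close>. So each state has distance at
  most \<open>d\<close> and lies in \<open>\<Lambda>\<close>. Charging only up to the exit is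
  enough, because no exit occurs.\<close>

lemma light_path_Lam:
  assumes "\<omega> \<in> Phi g t x" "walk K \<omega>" "dis K g t s x \<le> enat j" "j + exit_cost K (\<Lambda> - {g}) \<omega> \<le> d"
  shows "set \<omega> \<subseteq> \<Lambda>"
  using assms
proof (induction arbitrary: j rule: Phi_induct)
  case goal then show ?case by simp
next
  case (step x y \<omega>)
  have "dis K g t s x \<le> enat d" using step.prems by (auto intro: order_trans)
  then have x: "x \<in> \<Lambda>" by (simp add: Lam_def dis_goal)
  have "dis K g t s y \<le> enat (j + rate K x y)"
    using step by (intro dis_snoc) auto
  then show ?case using step.IH[of "j + rate K x y"] step x by (simp add: add.assoc)
qed

text \<open>The same invariant; each state is shown to lie in \<open>\<Lambda>\<close> before its
  outgoing rate is used, and there the modified rate is the original one.\<close>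

lemma light_mod_path_Lam:
  assumes "\<omega> \<in> Phi g t x" "walk K\<^sub>m \<omega>" "dis K g t s x \<le> enat j" "j + cost K\<^sub>m \<omega> \<le> d"
  shows "set \<omega> \<subseteq> \<Lambda>"
  using assms
proof (induction arbitrary: j rule: Phi_induct)
  case goal then show ?case by simp
next
  case (step x y \<omega>)
  have "dis K g t s x \<le> enat d" using step.prems by (auto intro: order_trans)
  then have x: "x \<in> \<Lambda>" by (simp add: Lam_def dis_goal)
  then have e: "edge K x y" and r: "rate K\<^sub>m x y = rate K x y"
      using step Lam_Gam_disjoint by (auto simp: mod_step)
  have "dis K g t s y \<le> enat (j + rate K x y)"
    using step e by (intro dis_snoc) auto
  then show ?case using step.IH[of "j + rate K x y"] step x r by (simp add: add.assoc)
qed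

lemma cost_ge_d: "\<omega> \<in> Phi g t s \<Longrightarrow> walk K \<omega> \<Longrightarrow> d \<le> cost K \<omega>"
  using dis_le[of \<omega> g t s g] by (simp add: Phi_def dis_goal)

lemma exit_cost_Lam: "\<omega> \<in> Phi g t x \<Longrightarrow> set \<omega> \<subseteq> \<Lambda> \<Longrightarrow> exit_cost K (\<Lambda> - {g}) \<omega> = cost K \<omega>"
  by (induction rule: Phi_induct) auto

lemma start_dis_le: "dis K g t s s \<le> enat 0"
  by (simp add: start_dis)

text \<open>In either chain an optimal path from \<open>s\<close> has cost at most \<open>d\<close>
  and hence stays in \<open>\<Lambda>\<close>, where the two chains agree.\<close>

lemma dbar_start: "dbar s = enat d"
proof (rule antisym)
  obtain \<omega> where w: "\<omega> \<in> Phi g t s" "walk K \<omega>" "cost K \<omega> = d"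
    using dis_attained[OF dis_goal] by (auto simp: Phi_def)
  then have "set \<omega> \<subseteq> \<Lambda>"
    using light_path_Lam[OF w(1,2) start_dis_le] exit_cost_le[of K "\<Lambda> - {g}" \<omega>] by simp
  then show "dbar s \<le> enat d" using dbar_le[OF w(1)] w by (simp add: mod_path_Lam)
  then obtain k where k: "dbar s = enat k" "k \<le> d" by (cases "dbar s") auto
  then obtain \<omega> where w: "\<omega> \<in> Phi g t s" "walk K\<^sub>m \<omega>" "cost K\<^sub>m \<omega> = k"
    using dbar_attained by blast
  then have "set \<omega> \<subseteq> \<Lambda>"
    using light_mod_path_Lam[OF w(1,2) start_dis_le] k by simp
  then have "walk K \<omega>" "cost K \<omega> = k" using w by (simp_all add: mod_path_Lam)
  then show "enat d \<le> dbar s" using cost_ge_d[OF w(1)] k by simp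
qed

lemma Delta_start_Lam: "\<omega> \<in> Delta K s g t s \<Longrightarrow> set \<omega> \<subseteq> \<Lambda>"
  using light_mod_path_Lam[OF _ _ start_dis_le, of \<omega>] by (simp add: Delta_eq dbar_start)

text \<open>The remaining walks are therefore those with \<open>Suc d \<le> exit_cost\<close>, the
  event that \<open>excess_bound\<close> estimates. An upper bound suffices on the right because a
  walk to \<open>g\<close> costs at least \<open>d\<close>.\<close>

lemma Delta_start_eq:
  "Delta K s g t s = {\<omega> \<in> Phi g t s. walk K \<omega> \<and> exit_cost K (\<Lambda> - {g}) \<omega> \<le> d}"
proof (intro set_eqI iffI)
  fix \<omega> assume w: "\<omega> \<in> Delta K s g t s"
  then show "\<omega> \<in> {\<omega> \<in> Phi g t s. walk K \<omega> \<and> exit_cost K (\<Lambda> - {g}) \<omega> \<le> d}"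
    using Delta_start_Lam[OF w] exit_cost_le[of K "\<Lambda> - {g}" \<omega>]
    by (simp add: Delta_eq dbar_start mod_path_Lam)
next
  fix \<omega> assume w: "\<omega> \<in> {\<omega> \<in> Phi g t s. walk K \<omega> \<and> exit_cost K (\<Lambda> - {g}) \<omega> \<le> d}"
  then have "set \<omega> \<subseteq> \<Lambda>" using light_path_Lam[OF _ _ start_dis_le, of \<omega>] by simp
  then show "\<omega> \<in> Delta K s g t s"
    using w cost_ge_d[of \<omega>] by (auto simp: Delta_eq dbar_start mod_path_Lam exit_cost_Lam)
qed

lemma Delta_start_cost:
  assumes "\<omega> \<in> Delta K s g t s"
  shows "walk K \<omega> \<and> cost K \<omega> = d"
proof -
  have "walk K\<^sub>m \<omega>" "cost K\<^sub>m \<omega> = d" using assms unfolding Delta_eq dbar_start by simp_all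
  then show ?thesis by (simp add: mod_path_Lam Delta_start_Lam[OF assms])
qed

lemma sum_path_coeff_pos:
  assumes "x \<in> \<Lambda> \<union> \<Gamma>" "dbar x = enat k"
  shows "(\<Sum>\<omega>\<in>Delta K s g t x. path_coeff K\<^sub>m \<omega>) > 0"
proof (rule sum_pos)
  obtain \<omega> where "\<omega> \<in> Phi g t x" "walk K\<^sub>m \<omega>" "cost K\<^sub>m \<omega> = k"
    using dbar_attained assms(2) by blast
  then have "\<omega> \<in> Delta K s g t x" using assms(2) by (simp add: Delta_eq)
  then show "Delta K s g t x \<noteq> {}" by blast
  show "finite (Delta K s g t x)" using assms finite_Delta by blast
qed (auto simp: Delta_eq intro: mod.path_limit(2))

lemma Delta_start_coeff:
  "(\<Sum>\<omega>\<in>Delta K s g t s. path_coeff K\<^sub>m \<omega>) = (\<Sum>\<omega>\<in>Delta K s g t s. path_coeff K \<omega>)"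
  using Delta_start_Lam by (intro sum.cong) (auto simp: mod_path_Lam)

section \<open>Asymptotics of weighted sums over paths\<close>

lemma weight_tendsto:
  assumes "\<omega> \<in> Phi g t x"
    and "\<And>x. x \<in> \<Lambda> - {t, g} \<Longrightarrow> ((\<lambda>\<epsilon>. \<rho> \<epsilon> x) \<longlongrightarrow> \<gamma> x) (at_right (0::real))"
  shows "((\<lambda>\<epsilon>. weight (\<Lambda> - {g}) (\<rho> \<epsilon>) \<omega>) \<longlongrightarrow> weight (\<Lambda> - {g}) \<gamma> \<omega>) (at_right 0)"
  using assms
proof (induction rule: Phi_induct)
  case (step x y \<omega>)
  then show ?case by (cases "x \<in> \<Lambda>") (auto intro!: tendsto_mult)
qed simp

lemma weight_nonneg: "(\<And>x. 0 \<le> \<rho> x) \<Longrightarrow> 0 \<le> weight L \<rho> \<omega>"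
  by (induction \<omega> rule: induct_list012) auto

lemma weight_one: "weight L (\<lambda>_. 1) \<omega> = 1"
  by (induction \<omega> rule: induct_list012) auto

text \<open>Finitely many limits are involved, so \<open>c\<close>, \<open>G\<close> and
  \<open>B\<close> can be fixed independently of \<epsilon>, and the potential at \<open>s\<close>
  is a constant times \<open>\<epsilon> ^ D\<close>.\<close>

lemma excess_bound:
  assumes \<rho>: "\<And>\<epsilon> x. \<epsilon> \<in> {0<..<\<epsilon>\<^sub>0} \<Longrightarrow> 0 \<le> \<rho> \<epsilon> x"
    and lim: "\<And>x. x \<in> \<Lambda> - {t, g} \<Longrightarrow> ((\<lambda>\<epsilon>. \<rho> \<epsilon> x) \<longlongrightarrow> \<gamma> x) (at_right (0::real))"
  shows "\<exists>C\<ge>0. eventually (\<lambda>\<epsilon>. (\<integral>\<^sup>+\<omega>. ennreal (path_prob K \<epsilon> \<omega> * weight (\<Lambda> - {g}) (\<rho> \<epsilon>) \<omega>) *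
       indicator {\<omega>. D \<le> exit_cost K (\<Lambda> - {g}) \<omega>} \<omega> \<partial>count_space (Phi g t s)) \<le> ennreal (C * \<epsilon> ^ D))
     (at_right 0)"
proof -
  obtain c where c: "c \<ge> 1" "eventually (\<lambda>\<epsilon>. \<forall>x\<in>\<Lambda>. \<forall>z\<in>\<Lambda> \<union> \<Gamma>. edge K x z \<longrightarrow>
      pmf (K \<epsilon> x) z \<le> c * \<epsilon> ^ rate K x z) (at_right 0)"
    using pmf_bound_ex by blast
  define G where "G = 1 + (\<Sum>x\<in>\<Lambda> - {t, g}. \<bar>\<gamma> x\<bar> + 1)"
  have "eventually (\<lambda>\<epsilon>. \<rho> \<epsilon> x \<le> G) (at_right 0)" if x: "x \<in> \<Lambda> - {t, g}" for x
  proof -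
    have "\<bar>\<gamma> x\<bar> + 1 \<le> (\<Sum>x\<in>\<Lambda> - {t, g}. \<bar>\<gamma> x\<bar> + 1)"
      using x finite_Lam by (intro member_le_sum) auto
    then have "\<gamma> x < G" unfolding G_def by linarith
    then have "eventually (\<lambda>\<epsilon>. \<rho> \<epsilon> x < G) (at_right 0)"
      by (intro order_tendstoD(2)[OF lim[OF x]])
    then show ?thesis by eventually_elim simp
  qed
  then have G: "eventually (\<lambda>\<epsilon>. \<forall>x\<in>\<Lambda> - {t, g}. \<rho> \<epsilon> x \<le> G) (at_right 0)"
    using finite_Lam by (intro eventually_ball_finite) auto
  have G1: "G \<ge> 1" unfolding G_def by (simp add: sum_nonneg)
  define \<beta> where "\<beta> = G * c * card (\<Lambda> \<union> \<Gamma>)"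
  define B where "B = \<beta> ^ Suc (card (\<Lambda> \<union> \<Gamma>))"
  have \<beta>: "\<beta> > 0" using G1 c card_pos by (simp add: \<beta>_def)
  then have B0: "B > 0" by (simp add: B_def)
  then have "eventually (\<lambda>\<epsilon>. \<epsilon> \<in> {0<..<1 / B}) (at_right 0)"
    by (intro eventually_at_right_less) simp
  then have "eventually (\<lambda>\<epsilon>. (\<integral>\<^sup>+\<omega>. ennreal (path_prob K \<epsilon> \<omega> * weight (\<Lambda> - {g}) (\<rho> \<epsilon>) \<omega>) *
       indicator {\<omega>. D \<le> exit_cost K (\<Lambda> - {g}) \<omega>} \<omega> \<partial>count_space (Phi g t s))
       \<le> ennreal (\<beta> ^ height s * B ^ D * \<epsilon> ^ D)) (at_right 0)"
    using eventually_small c(2) G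
  proof eventually_elim
    case (elim \<epsilon>)
    have "B * \<epsilon> \<le> 1" using elim(1) B0 by (simp add: field_simps)
    note bound = excess_bound_upto[where \<rho> = "\<rho> \<epsilon>" and j = 0 and D = D and x = s, OF elim(2) c(1) _
        \<rho>[OF elim(2)] _ G1 \<beta>_def B_def this]
    show ?case
      using elim bound by (intro nn_integral_Phi_le) (simp add: power_mult_distrib mult.assoc)
  qed
  moreover have "\<beta> ^ height s * B ^ D \<ge> 0" using \<beta> B0 by simp
  ultimately show ?thesis by blast
qed

text \<open>Used for both moments, with weights 1 and with the ratios. The sum is passed on as a
  real function \<open>f\<close>, so that limits can be taken in the reals.\<close>

lemma weighted_sum_asymptotics:
  assumes \<rho>: "\<And>\<epsilon> x. \<epsilon> \<in> {0<..<\<epsilon>\<^sub>0} \<Longrightarrow> 0 \<le> \<rho> \<epsilon> x"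
    and lim: "\<And>x. x \<in> \<Lambda> - {t, g} \<Longrightarrow> ((\<lambda>\<epsilon>. \<rho> \<epsilon> x) \<longlongrightarrow> \<gamma> x) (at_right (0::real))"
  obtains f where
    "eventually (\<lambda>\<epsilon>. (\<integral>\<^sup>+\<omega>. ennreal (path_prob K \<epsilon> \<omega> * weight (\<Lambda> - {g}) (\<rho> \<epsilon>) \<omega>)
       \<partial>count_space (Phi g t s)) = ennreal (f \<epsilon>) \<and> f \<epsilon> \<ge> 0) (at_right 0)"
    "((\<lambda>\<epsilon>. f \<epsilon> / \<epsilon> ^ d) \<longlongrightarrow>
       (\<Sum>\<omega>\<in>Delta K s g t s. path_coeff K \<omega> * weight (\<Lambda> - {g}) \<gamma> \<omega>)) (at_right 0)"
proof -
  let ?\<Delta> = "Delta K s g t s"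
  let ?p = "\<lambda>\<epsilon> \<omega>. path_prob K \<epsilon> \<omega> * weight (\<Lambda> - {g}) (\<rho> \<epsilon>) \<omega>"
  define h where "h = (\<lambda>\<epsilon>. \<integral>\<^sup>+\<omega>. ennreal (?p \<epsilon> \<omega>) *
       indicator {\<omega>. Suc d \<le> exit_cost K (\<Lambda> - {g}) \<omega>} \<omega> \<partial>count_space (Phi g t s))"
  define f where "f = (\<lambda>\<epsilon>. (\<Sum>\<omega>\<in>?\<Delta>. ?p \<epsilon> \<omega>) + enn2real (h \<epsilon>))"
  have fin: "finite ?\<Delta>" by (rule finite_Delta) simp
  have sub: "?\<Delta> \<subseteq> Phi g t s" by (auto simp: Delta_start_eq)
  have pos: "0 \<le> ?p \<epsilon> \<omega>" if "\<epsilon> \<in> {0<..<\<epsilon>\<^sub>0}" for \<epsilon> \<omega>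
    using \<rho>[OF that] weight_nonneg[of "\<rho> \<epsilon>"] by simp
  obtain C where C: "C \<ge> 0" "eventually (\<lambda>\<epsilon>. h \<epsilon> \<le> ennreal (C * \<epsilon> ^ Suc d)) (at_right 0)"
    using excess_bound[where \<rho> = \<rho> and D = "Suc d", OF \<rho> lim] unfolding h_def by blast
  have split: "(\<integral>\<^sup>+\<omega>. ennreal (?p \<epsilon> \<omega>) \<partial>count_space (Phi g t s)) = ennreal (\<Sum>\<omega>\<in>?\<Delta>. ?p \<epsilon> \<omega>) + h \<epsilon>"
    if e: "\<epsilon> \<in> {0<..<\<epsilon>\<^sub>0}" for \<epsilon>
  proof -
    \<comment> \<open>The two events split the walks, and any other list has probability 0 and adds
      nothing to either part.\<close>
    have "(\<integral>\<^sup>+\<omega>. ennreal (?p \<epsilon> \<omega>) \<partial>count_space (Phi g t s)) =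
        (\<integral>\<^sup>+\<omega>. ennreal (?p \<epsilon> \<omega>) * indicator ?\<Delta> \<omega> + ennreal (?p \<epsilon> \<omega>) *
          indicator {\<omega>. Suc d \<le> exit_cost K (\<Lambda> - {g}) \<omega>} \<omega> \<partial>count_space (Phi g t s))"
    proof (rule nn_integral_cong)
      fix \<omega> assume "\<omega> \<in> space (count_space (Phi g t s))"
      moreover have "path_prob K \<epsilon> \<omega> = 0" if "\<not> walk K \<omega>"
        using that walk_iff[OF e] path_prob_nonneg[of K \<epsilon> \<omega>] by (simp add: less_le)
      ultimately show "ennreal (?p \<epsilon> \<omega>) = ennreal (?p \<epsilon> \<omega>) * indicator ?\<Delta> \<omega> + ennreal (?p \<epsilon> \<omega>) *
          indicator {\<omega>. Suc d \<le> exit_cost K (\<Lambda> - {g}) \<omega>} \<omega>"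
        by (auto simp: Delta_start_eq indicator_def not_le)
    qed
    also have "\<dots> = (\<integral>\<^sup>+\<omega>. ennreal (?p \<epsilon> \<omega>) * indicator ?\<Delta> \<omega> \<partial>count_space (Phi g t s)) + h \<epsilon>"
      unfolding h_def by (intro nn_integral_add) auto
    also have "(\<integral>\<^sup>+\<omega>. ennreal (?p \<epsilon> \<omega>) * indicator ?\<Delta> \<omega> \<partial>count_space (Phi g t s)) =
        (\<Sum>\<omega>\<in>?\<Delta>. ennreal (?p \<epsilon> \<omega>))"
    proof -
      have "(\<integral>\<^sup>+\<omega>. ennreal (?p \<epsilon> \<omega>) * indicator ?\<Delta> \<omega> \<partial>count_space (Phi g t s)) =
          (\<Sum>\<omega>\<in>?\<Delta>. ennreal (?p \<epsilon> \<omega>) * indicator ?\<Delta> \<omega>)"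
        using fin sub by (intro nn_integral_count_space'[of ?\<Delta>]) auto
      then show ?thesis by simp
    qed
    also have "\<dots> = ennreal (\<Sum>\<omega>\<in>?\<Delta>. ?p \<epsilon> \<omega>)"
      using pos[OF e] by (intro sum_ennreal) auto
    finally show ?thesis .
  qed
  have h0: "((\<lambda>\<epsilon>. enn2real (h \<epsilon>) / \<epsilon> ^ d) \<longlongrightarrow> 0) (at_right 0)"
  proof (rule tendsto_sandwich)
    show "eventually (\<lambda>\<epsilon>. 0 \<le> enn2real (h \<epsilon>) / \<epsilon> ^ d) (at_right 0)"
      using eventually_small by eventually_elim simp
    show "eventually (\<lambda>\<epsilon>. enn2real (h \<epsilon>) / \<epsilon> ^ d \<le> C * \<epsilon>) (at_right 0)"
      using eventually_small C(2)
    proof eventually_elim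
      case (elim \<epsilon>)
      then have "enn2real (h \<epsilon>) \<le> C * \<epsilon> ^ Suc d"
        using C(1) by (intro enn2real_leI) auto
      then show ?case using elim by (simp add: field_simps)
    qed
    have "((\<lambda>\<epsilon>. C * \<epsilon>) \<longlongrightarrow> C * 0) (at_right 0)" by (intro tendsto_intros)
    then show "((\<lambda>\<epsilon>. C * \<epsilon>) \<longlongrightarrow> 0) (at_right 0)" by simp
  qed simp
  have "((\<lambda>\<epsilon>. (\<Sum>\<omega>\<in>?\<Delta>. path_prob K \<epsilon> \<omega> / \<epsilon> ^ cost K \<omega> * weight (\<Lambda> - {g}) (\<rho> \<epsilon>) \<omega>) + enn2real (h \<epsilon>) / \<epsilon> ^ d)
      \<longlongrightarrow> (\<Sum>\<omega>\<in>?\<Delta>. path_coeff K \<omega> * weight (\<Lambda> - {g}) \<gamma> \<omega>) + 0) (at_right 0)"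
    using Delta_start_cost sub
    by (intro tendsto_add tendsto_sum tendsto_mult path_limit weight_tendsto h0 lim) auto
  moreover have "(\<Sum>\<omega>\<in>?\<Delta>. path_prob K \<epsilon> \<omega> / \<epsilon> ^ cost K \<omega> * weight (\<Lambda> - {g}) (\<rho> \<epsilon>) \<omega>) + enn2real (h \<epsilon>) / \<epsilon> ^ d
      = f \<epsilon> / \<epsilon> ^ d" for \<epsilon>
    using Delta_start_cost by (simp add: f_def add_divide_distrib sum_divide_distrib)
  ultimately have "((\<lambda>\<epsilon>. f \<epsilon> / \<epsilon> ^ d) \<longlongrightarrow>
       (\<Sum>\<omega>\<in>?\<Delta>. path_coeff K \<omega> * weight (\<Lambda> - {g}) \<gamma> \<omega>)) (at_right 0)" by simp
  moreover have "eventually (\<lambda>\<epsilon>. (\<integral>\<^sup>+\<omega>. ennreal (?p \<epsilon> \<omega>) \<partial>count_space (Phi g t s)) = ennreal (f \<epsilon>) \<and> f \<epsilon> \<ge> 0)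
      (at_right 0)"
    using eventually_small C(2)
  proof eventually_elim
    case (elim \<epsilon>)
    have "h \<epsilon> < \<top>" using elim(2) by (rule le_less_trans) simp
    moreover have "(\<Sum>\<omega>\<in>?\<Delta>. ?p \<epsilon> \<omega>) \<ge> 0" using pos[OF elim(1)] by (intro sum_nonneg) auto
    ultimately show ?case using split[OF elim(1)] by (simp add: f_def)
  qed
  ultimately show ?thesis using that by blast
qed

end

section \<open>Relative error of the importance sampling estimator\<close>

text \<open>A path that never exits has index \<infinity>, the infimum of the empty set; the guard
  \<open>j < length \<omega>\<close> accounts for it when \<open>i\<close> lies beyond the
  end.\<close>

lemma exit_index_greater_iff:
  "enat i < exit_index K s g t \<omega> \<longleftrightarrow> (\<forall>j\<le>i. j < length \<omega> \<longrightarrow> \<omega> ! j \<in> Lam K s g t - {g})"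
proof -
  let ?X = "{enat i | i. i < length \<omega> \<and> (\<omega> ! i \<notin> Lam K s g t \<or> \<omega> ! i = g)}"
  have "Inf ?X \<le> enat i \<longleftrightarrow> (\<exists>j\<le>i. enat j \<in> ?X)"
  proof
    assume le: "Inf ?X \<le> enat i"
    have "?X \<noteq> {}"
    proof
      assume "?X = {}"
      with le have "Inf {} \<le> enat i" by (simp only:)
      then show False by (simp add: top_enat_def)
    qed
    then obtain e where "e \<in> ?X" by blast
    from wellorder_InfI[of e ?X, OF this] obtain j where "Inf ?X = enat j" "enat j \<in> ?X" by auto
    with le show "\<exists>j\<le>i. enat j \<in> ?X" by (intro exI[of _ j]) simp
  next
    assume "\<exists>j\<le>i. enat j \<in> ?X"
    then obtain j where j: "j \<le> i" "enat j \<in> ?X" by blast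
    from Inf_lower[OF j(2)] show "Inf ?X \<le> enat i" by (rule order_trans) (use j(1) in simp)
  qed
  then show ?thesis unfolding exit_index_def not_le[symmetric] by auto
qed

lemma q_step_0:
  "q_step K s g t v \<epsilon> (x # y # \<omega>) 0 =
    (if x \<in> Lam K s g t - {g}
     then pmf (mod_chain K s g t \<epsilon> x) y * v \<epsilon> y / (\<Sum>\<^sub>\<infinity>z. pmf (mod_chain K s g t \<epsilon> x) z * v \<epsilon> z)
     else pmf (K \<epsilon> x) y)"
  by (simp add: q_step_def exit_index_greater_iff)

text \<open>A head outside \<open>Lam - {g}\<close> gives exit index 0, so that all later steps
  follow \<open>K\<close>; otherwise the exit index is that of the tail plus 1.\<close>

lemma q_step_Suc:
  assumes "i < length \<omega>"
  shows "q_step K s g t v \<epsilon> (x # y # \<omega>) (Suc i) =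
    (if x \<in> Lam K s g t - {g} then q_step K s g t v \<epsilon> (y # \<omega>) i
     else pmf (K \<epsilon> ((y # \<omega>) ! i)) ((y # \<omega>) ! Suc i))"
proof -
  have "enat (Suc i) < exit_index K s g t (x # y # \<omega>) \<longleftrightarrow>
      x \<in> Lam K s g t - {g} \<and> enat i < exit_index K s g t (y # \<omega>)"
    unfolding exit_index_greater_iff
  proof (intro iffI conjI allI impI)
    fix j assume "\<forall>j\<le>Suc i. j < length (x # y # \<omega>) \<longrightarrow> (x # y # \<omega>) ! j \<in> Lam K s g t - {g}"
      and "j \<le> i" "j < length (y # \<omega>)"
    then show "(y # \<omega>) ! j \<in> Lam K s g t - {g}" by (auto dest!: spec[of _ "Suc j"])
  next
    fix j assume "x \<in> Lam K s g t - {g} \<and> (\<forall>j\<le>i. j < length (y # \<omega>) \<longrightarrow> (y # \<omega>) ! j \<in> Lam K s g t - {g})"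
      and "j \<le> Suc i" "j < length (x # y # \<omega>)"
    then show "(x # y # \<omega>) ! j \<in> Lam K s g t - {g}" by (cases j) auto
  qed (auto dest!: spec[of _ 0])
  then show ?thesis by (auto simp: q_step_def)
qed

lemma path_prob_Q_single [simp]: "path_prob_Q K s g t v \<epsilon> [x] = 1"
  by (simp add: path_prob_Q_def)

lemma path_prob_Q_Cons:
  "path_prob_Q K s g t v \<epsilon> (x # y # \<omega>) =
    (if x \<in> Lam K s g t - {g}
     then pmf (mod_chain K s g t \<epsilon> x) y * v \<epsilon> y / (\<Sum>\<^sub>\<infinity>z. pmf (mod_chain K s g t \<epsilon> x) z * v \<epsilon> z) *
       path_prob_Q K s g t v \<epsilon> (y # \<omega>)
     else path_prob K \<epsilon> (x # y # \<omega>))"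
proof -
  have "path_prob_Q K s g t v \<epsilon> (x # y # \<omega>) = q_step K s g t v \<epsilon> (x # y # \<omega>) 0 *
      (\<Prod>i<length \<omega>. q_step K s g t v \<epsilon> (x # y # \<omega>) (Suc i))"
    by (simp add: path_prob_Q_def prod.lessThan_Suc_shift del: prod.lessThan_Suc)
  also have "(\<Prod>i<length \<omega>. q_step K s g t v \<epsilon> (x # y # \<omega>) (Suc i)) =
      (\<Prod>i<length \<omega>. if x \<in> Lam K s g t - {g} then q_step K s g t v \<epsilon> (y # \<omega>) i
         else pmf (K \<epsilon> ((y # \<omega>) ! i)) ((y # \<omega>) ! Suc i))"
    by (intro prod.cong refl q_step_Suc) simp
  finally show ?thesis
    by (auto simp: q_step_0 path_prob_Q_def path_prob_def[of K \<epsilon> "y # \<omega>"])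
qed

section \<open>Telescoping of the likelihood ratio\<close>

context rare_event_chain
begin

definition ratio :: "(real \<Rightarrow> 'a \<Rightarrow> real) \<Rightarrow> real \<Rightarrow> 'a \<Rightarrow> real" where
  "ratio v \<epsilon> x = (\<Sum>\<^sub>\<infinity>z. pmf (K\<^sub>m \<epsilon> x) z * v \<epsilon> z) / v \<epsilon> x"

text \<open>A finite sum over edges, fixed in advance of \<epsilon>, lets limits be taken term by
  term.\<close>

lemma infsum_successors:
  assumes "x \<in> \<Lambda>" "\<epsilon> \<in> {0<..<\<epsilon>\<^sub>0}"
  shows "(\<Sum>\<^sub>\<infinity>z. pmf (K\<^sub>m \<epsilon> x) z * v \<epsilon> z) = (\<Sum>z\<in>{z \<in> \<Lambda> \<union> \<Gamma>. edge K x z}. pmf (K \<epsilon> x) z * v \<epsilon> z)"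
proof -
  have "(\<Sum>\<^sub>\<infinity>z. pmf (K\<^sub>m \<epsilon> x) z * v \<epsilon> z) = (\<Sum>\<^sub>\<infinity>z\<in>{z \<in> \<Lambda> \<union> \<Gamma>. edge K x z}. pmf (K \<epsilon> x) z * v \<epsilon> z)"
    using edge_Lam[OF assms(1)] no_edge[OF assms(2), of x] Lam_Gam_disjoint[OF assms(1)]
    by (intro infsum_cong_neutral) (auto simp: mod_chain_other)
  also have "\<dots> = (\<Sum>z\<in>{z \<in> \<Lambda> \<union> \<Gamma>. edge K x z}. pmf (K \<epsilon> x) z * v \<epsilon> z)"
    using finite_Lam finite_Gam by (intro infsum_finite) auto
  finally show ?thesis .
qed

end

text \<open>What the two choices of \<open>v\<close> share. The value 1 at the exits ends the
  telescoping product; a positive limit \<open>c\<close> keeps the denominators from vanishing for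
  small \<epsilon>.\<close>

locale value_function = rare_event_chain K \<epsilon>\<^sub>0 s g t
  for K :: "'a chain" and \<epsilon>\<^sub>0 s g t +
  fixes v :: "real \<Rightarrow> 'a \<Rightarrow> real" and c \<gamma> :: "'a \<Rightarrow> real"
  assumes v_nonneg: "\<epsilon> > 0 \<Longrightarrow> 0 \<le> v \<epsilon> x"
    and v_exit: "\<epsilon> > 0 \<Longrightarrow> x = g \<or> x \<in> \<Gamma> - {t} \<Longrightarrow> v \<epsilon> x = 1"
    and v_infinite: "\<epsilon> > 0 \<Longrightarrow> dbar x = \<infinity> \<Longrightarrow> v \<epsilon> x = 0"
    and v_limit: "x \<in> \<Lambda> \<union> \<Gamma> \<Longrightarrow> dbar x = enat k \<Longrightarrow> ((\<lambda>\<epsilon>. v \<epsilon> x / \<epsilon> ^ k) \<longlongrightarrow> c x) (at_right 0)"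
    and c_pos: "x \<in> \<Lambda> \<union> \<Gamma> \<Longrightarrow> dbar x \<noteq> \<infinity> \<Longrightarrow> c x > 0"
    and ratio_limit: "x \<in> \<Lambda> - {t, g} \<Longrightarrow> dbar x \<noteq> \<infinity> \<Longrightarrow> ((\<lambda>\<epsilon>. ratio v \<epsilon> x) \<longlongrightarrow> \<gamma> x) (at_right 0)"
begin

text \<open>At infinite distance \<open>v\<close> vanishes and \<open>ratio\<close> is 0, being a
  division by 0. With this value the ratios converge on all of \<open>\<Lambda> - {t, g}\<close>, as
  the asymptotics of weighted sums require.\<close>

definition \<gamma>\<^sub>0 :: "'a \<Rightarrow> real" where
  "\<gamma>\<^sub>0 x = (if dbar x = \<infinity> then 0 else \<gamma> x)"

lemma ratio_nonneg: "\<epsilon> > 0 \<Longrightarrow> 0 \<le> ratio v \<epsilon> x"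
  using v_nonneg by (auto simp: ratio_def intro!: divide_nonneg_nonneg infsum_nonneg)

lemma ratio_limit_all:
  assumes "x \<in> \<Lambda> - {t, g}" shows "((\<lambda>\<epsilon>. ratio v \<epsilon> x) \<longlongrightarrow> \<gamma>\<^sub>0 x) (at_right 0)"
proof (cases "dbar x = \<infinity>")
  case True
  then have "eventually (\<lambda>\<epsilon>. ratio v \<epsilon> x = 0) (at_right 0)"
    using eventually_small by (auto elim!: eventually_mono simp: ratio_def v_infinite)
  then show ?thesis using True by (simp add: \<gamma>\<^sub>0_def tendsto_eventually)
next
  case False
  then show ?thesis using ratio_limit[OF assms False] by (simp only: \<gamma>\<^sub>0_def if_False)
qed

lemma v_pos_eventually:
  "eventually (\<lambda>\<epsilon>. \<forall>x\<in>\<Lambda> \<union> \<Gamma>. dbar x \<noteq> \<infinity> \<longrightarrow> v \<epsilon> x > 0) (at_right 0)"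
proof -
  have "eventually (\<lambda>\<epsilon>. dbar x \<noteq> \<infinity> \<longrightarrow> v \<epsilon> x > 0) (at_right 0)" if x: "x \<in> \<Lambda> \<union> \<Gamma>" for x
  proof (cases "dbar x")
    case (enat k)
    have "eventually (\<lambda>\<epsilon>. v \<epsilon> x / \<epsilon> ^ k > 0) (at_right 0)"
      using c_pos[OF x] enat by (intro order_tendstoD(1)[OF v_limit[OF x enat]]) simp
    with eventually_small show ?thesis
      by eventually_elim (auto simp: zero_less_divide_iff)
  qed simp
  then show ?thesis using finite_Lam finite_Gam by (intro eventually_ball_finite) auto
qed

text \<open>Inside \<open>\<Lambda>\<close> a step multiplies P/Q by the ratio at \<open>x\<close>
  times v(x) / v(y), which telescopes; from the exit on P and Q agree, and v is 1 there. The
  identity is written as a product, to be free of division by Q.\<close>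

lemma likelihood_ratio:
  assumes "\<omega> \<in> Phi g t x" "walk K \<omega>" "x \<in> \<Lambda> \<union> \<Gamma>"
    and \<epsilon>: "\<epsilon> \<in> {0<..<\<epsilon>\<^sub>0}" and pos: "\<forall>x\<in>\<Lambda> \<union> \<Gamma>. dbar x \<noteq> \<infinity> \<longrightarrow> v \<epsilon> x > 0"
  shows "path_prob K \<epsilon> \<omega> =
    path_prob_Q K s g t v \<epsilon> \<omega> * (v \<epsilon> x * weight (\<Lambda> - {g}) (ratio v \<epsilon>) \<omega>)"
  using assms(1-3)
proof (induction rule: Phi_induct)
  case goal then show ?case using v_exit[of \<epsilon> g] \<epsilon> by simp
next
  case (step x y \<omega>)
  have e: "\<epsilon> > 0" using \<epsilon> by simp
  show ?case
  proof (cases "x \<in> \<Lambda>")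
    case True
    let ?w = "\<Sum>\<^sub>\<infinity>z. pmf (K\<^sub>m \<epsilon> x) z * v \<epsilon> z"
    have y: "y \<in> \<Lambda> \<union> \<Gamma>" "edge K x y" using True step edge_Lam by auto
    have "dbar x \<noteq> \<infinity>" "dbar y \<noteq> \<infinity>"
      using dbar_finite[of "x # y # \<omega>" x] dbar_finite[of "y # \<omega>" y] step y
        Phi_Cons[OF step(1,2)] by simp_all
    then have vx: "v \<epsilon> x > 0" and vy: "v \<epsilon> y > 0" using pos step y by auto
    have "pmf (K \<epsilon> x) y * v \<epsilon> y \<le> (\<Sum>z\<in>{z \<in> \<Lambda> \<union> \<Gamma>. edge K x z}. pmf (K \<epsilon> x) z * v \<epsilon> z)"
      using y finite_Lam finite_Gam v_nonneg[OF e]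
      by (intro member_le_sum[where f = "\<lambda>z. pmf (K \<epsilon> x) z * v \<epsilon> z"]) auto
    also have "\<dots> = ?w" using infsum_successors[OF True \<epsilon>] by simp
    \<comment> \<open>The term of \<open>y\<close> alone makes the denominator positive.\<close>
    finally have w: "?w > 0" using vy y edge_iff[OF \<epsilon>, of x y]
      by (meson less_le_trans mult_pos_pos)
    have m: "K\<^sub>m \<epsilon> x = K \<epsilon> x" using True Lam_Gam_disjoint by (simp add: mod_chain_other)
    have IH: "path_prob K \<epsilon> (y # \<omega>) = path_prob_Q K s g t v \<epsilon> (y # \<omega>) *
        (v \<epsilon> y * weight (\<Lambda> - {g}) (ratio v \<epsilon>) (y # \<omega>))"
      using step y by simp
    have Q: "path_prob_Q K s g t v \<epsilon> (x # y # \<omega>) =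
        pmf (K \<epsilon> x) y * v \<epsilon> y / ?w * path_prob_Q K s g t v \<epsilon> (y # \<omega>)"
      using True step(1) by (simp add: path_prob_Q_Cons m)
    have W: "weight (\<Lambda> - {g}) (ratio v \<epsilon>) (x # y # \<omega>) =
        ?w / v \<epsilon> x * weight (\<Lambda> - {g}) (ratio v \<epsilon>) (y # \<omega>)"
      using True step(1) by (simp add: ratio_def)
    show ?thesis unfolding path_prob_Cons IH Q W using w vx by (simp add: field_simps)
  next
    case False
    then show ?thesis using step v_exit[OF e, of x] by (simp add: path_prob_Q_Cons)
  qed
qed

text \<open>On walks Q is nonzero, so Q (P/Q) = P and Q (P/Q)^2 = P (P/Q). The trivial weight in the
  first moment gives both moments the form of \<open>weighted_sum_asymptotics\<close>.\<close>

lemma expectations: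
  assumes \<epsilon>: "\<epsilon> \<in> {0<..<\<epsilon>\<^sub>0}" and pos: "\<forall>x\<in>\<Lambda> \<union> \<Gamma>. dbar x \<noteq> \<infinity> \<longrightarrow> v \<epsilon> x > 0"
  shows "expect_Q K s g t v \<epsilon> (estimator K s g t v \<epsilon>) =
      (\<integral>\<^sup>+\<omega>. ennreal (path_prob K \<epsilon> \<omega> * weight (\<Lambda> - {g}) (\<lambda>_. 1) \<omega>) \<partial>count_space (Phi g t s))"
    and "expect_Q K s g t v \<epsilon> (\<lambda>\<omega>. (estimator K s g t v \<epsilon> \<omega>)\<^sup>2) = ennreal (v \<epsilon> s) *
      (\<integral>\<^sup>+\<omega>. ennreal (path_prob K \<epsilon> \<omega> * weight (\<Lambda> - {g}) (ratio v \<epsilon>) \<omega>) \<partial>count_space (Phi g t s))"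
proof -
  let ?P = "path_prob K \<epsilon>" and ?Q = "path_prob_Q K s g t v \<epsilon>"
  let ?W = "weight (\<Lambda> - {g}) (ratio v \<epsilon>)"
  have Phi: "(\<integral>\<^sup>+\<omega>. F \<omega> \<partial>count_space (stopped_paths g t s)) = (\<integral>\<^sup>+\<omega>. G \<omega> \<partial>count_space (Phi g t s))"
    if "\<And>\<omega>. \<omega> \<in> Phi g t s \<Longrightarrow> F \<omega> = G \<omega>" "\<And>\<omega>. \<omega> \<notin> Phi g t s \<Longrightarrow> F \<omega> = 0" for F G :: "'a list \<Rightarrow> ennreal"
  proof -
    have "Phi g t s \<subseteq> stopped_paths g t s" by (auto simp: Phi_def stopped_paths_def)
    then have "F \<omega> * indicator (stopped_paths g t s) \<omega> = G \<omega> * indicator (Phi g t s) \<omega>" for \<omega>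
      using that by (cases "\<omega> \<in> Phi g t s") (auto simp: indicator_def)
    then show ?thesis by (simp add: nn_integral_count_space_indicator)
  qed
  have P0: "?P \<omega> = 0" if "\<not> walk K \<omega>" for \<omega>
    using that walk_iff[OF \<epsilon>] path_prob_nonneg[of K \<epsilon> \<omega>] by (simp add: less_le)
  have PQ: "?P \<omega> = ?Q \<omega> * (v \<epsilon> s * ?W \<omega>)" "?Q \<omega> \<noteq> 0" if "\<omega> \<in> Phi g t s" "walk K \<omega>" for \<omega>
  proof -
    show "?P \<omega> = ?Q \<omega> * (v \<epsilon> s * ?W \<omega>)" using likelihood_ratio[OF that _ \<epsilon> pos] by simp
    then show "?Q \<omega> \<noteq> 0" using walk_iff[OF \<epsilon>, of \<omega>] that by auto
  qed
  show "expect_Q K s g t v \<epsilon> (estimator K s g t v \<epsilon>) =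
      (\<integral>\<^sup>+\<omega>. ennreal (?P \<omega> * weight (\<Lambda> - {g}) (\<lambda>_. 1) \<omega>) \<partial>count_space (Phi g t s))"
    unfolding expect_Q_def
  proof (rule Phi)
    fix \<omega> assume "\<omega> \<in> Phi g t s"
    then show "ennreal (?Q \<omega> * estimator K s g t v \<epsilon> \<omega>) = ennreal (?P \<omega> * weight (\<Lambda> - {g}) (\<lambda>_. 1) \<omega>)"
      using PQ(2)[of \<omega>] P0[of \<omega>] by (cases "walk K \<omega>") (auto simp: estimator_def weight_one)
  qed (simp add: estimator_def)
  have "expect_Q K s g t v \<epsilon> (\<lambda>\<omega>. (estimator K s g t v \<epsilon> \<omega>)\<^sup>2) =
      (\<integral>\<^sup>+\<omega>. ennreal (v \<epsilon> s) * ennreal (?P \<omega> * ?W \<omega>) \<partial>count_space (Phi g t s))"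
    unfolding expect_Q_def
  proof (rule Phi)
    fix \<omega> assume w: "\<omega> \<in> Phi g t s"
    have "?Q \<omega> * (estimator K s g t v \<epsilon> \<omega>)\<^sup>2 = v \<epsilon> s * (?P \<omega> * ?W \<omega>)"
    proof (cases "walk K \<omega>")
      case True
      have "?Q \<omega> * (estimator K s g t v \<epsilon> \<omega>)\<^sup>2 = ?P \<omega> * (?P \<omega> / ?Q \<omega>)"
        using w PQ(2)[OF w True] by (simp add: estimator_def power2_eq_square)
      also have "?P \<omega> / ?Q \<omega> = v \<epsilon> s * ?W \<omega>"
        using PQ[OF w True] by simp
      finally show ?thesis by simp
    qed (simp add: P0 estimator_def)
    then show "ennreal (?Q \<omega> * (estimator K s g t v \<epsilon> \<omega>)\<^sup>2) = ennreal (v \<epsilon> s) * ennreal (?P \<omega> * ?W \<omega>)"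
      using v_nonneg \<epsilon> by (simp add: ennreal_mult'[symmetric])
  qed (simp add: estimator_def)
  then show "expect_Q K s g t v \<epsilon> (\<lambda>\<omega>. (estimator K s g t v \<epsilon> \<omega>)\<^sup>2) = ennreal (v \<epsilon> s) *
      (\<integral>\<^sup>+\<omega>. ennreal (?P \<omega> * ?W \<omega>) \<partial>count_space (Phi g t s))"
    by (simp add: nn_integral_cmult)
qed

text \<open>Both the second moment and the squared first moment scale like
  \<open>\<epsilon> ^ (2 * d)\<close>, half of the power in the former coming from
  \<open>v \<epsilon> s\<close>; the powers cancel in the quotient.\<close>

lemma rel_error_tendsto:
  defines "\<alpha> \<equiv> \<Sum>\<omega>\<in>Delta K s g t s. path_coeff K \<omega>"
  shows "((\<lambda>\<epsilon>. rel_error K s g t v \<epsilon>) \<longlongrightarrow>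
    ennreal (c s * (\<Sum>\<omega>\<in>Delta K s g t s. path_coeff K \<omega> * weight (\<Lambda> - {g}) \<gamma>\<^sub>0 \<omega>) / \<alpha>\<^sup>2 - 1)) (at_right 0)"
proof -
  have \<alpha>: "\<alpha> > 0"
    using sum_path_coeff_pos[of s d] dbar_start by (simp add: \<alpha>_def Delta_start_coeff)
  obtain f where f: "eventually (\<lambda>\<epsilon>. (\<integral>\<^sup>+\<omega>. ennreal (path_prob K \<epsilon> \<omega> * weight (\<Lambda> - {g}) (\<lambda>_. 1) \<omega>)
       \<partial>count_space (Phi g t s)) = ennreal (f \<epsilon>) \<and> f \<epsilon> \<ge> 0) (at_right 0)"
    "((\<lambda>\<epsilon>. f \<epsilon> / \<epsilon> ^ d) \<longlongrightarrow> \<alpha>) (at_right 0)"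
    using weighted_sum_asymptotics[where \<rho> = "\<lambda>_ _. 1" and \<gamma> = "\<lambda>_. 1"]
    by (auto simp: weight_one \<alpha>_def)
  have nonneg: "0 \<le> ratio v \<epsilon> x" if "\<epsilon> \<in> {0<..<\<epsilon>\<^sub>0}" for \<epsilon> x
    using that by (simp add: ratio_nonneg)
  obtain h where h: "eventually (\<lambda>\<epsilon>. (\<integral>\<^sup>+\<omega>. ennreal (path_prob K \<epsilon> \<omega> * weight (\<Lambda> - {g}) (ratio v \<epsilon>) \<omega>)
       \<partial>count_space (Phi g t s)) = ennreal (h \<epsilon>) \<and> h \<epsilon> \<ge> 0) (at_right 0)"
    "((\<lambda>\<epsilon>. h \<epsilon> / \<epsilon> ^ d) \<longlongrightarrow>
       (\<Sum>\<omega>\<in>Delta K s g t s. path_coeff K \<omega> * weight (\<Lambda> - {g}) \<gamma>\<^sub>0 \<omega>)) (at_right 0)"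
    by (rule weighted_sum_asymptotics[OF nonneg ratio_limit_all])
  have "((\<lambda>\<epsilon>. (v \<epsilon> s / \<epsilon> ^ d) * (h \<epsilon> / \<epsilon> ^ d) / (f \<epsilon> / \<epsilon> ^ d)\<^sup>2 - 1) \<longlongrightarrow>
      c s * (\<Sum>\<omega>\<in>Delta K s g t s. path_coeff K \<omega> * weight (\<Lambda> - {g}) \<gamma>\<^sub>0 \<omega>) / \<alpha>\<^sup>2 - 1) (at_right 0)"
    using \<alpha> by (intro tendsto_intros h f v_limit dbar_start) auto
  then have lim: "((\<lambda>\<epsilon>. ennreal ((v \<epsilon> s / \<epsilon> ^ d) * (h \<epsilon> / \<epsilon> ^ d) / (f \<epsilon> / \<epsilon> ^ d)\<^sup>2 - 1)) \<longlongrightarrow>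
      ennreal (c s * (\<Sum>\<omega>\<in>Delta K s g t s. path_coeff K \<omega> * weight (\<Lambda> - {g}) \<gamma>\<^sub>0 \<omega>) / \<alpha>\<^sup>2 - 1)) (at_right 0)"
    by (rule tendsto_ennrealI)
  have "eventually (\<lambda>\<epsilon>. f \<epsilon> / \<epsilon> ^ d > 0) (at_right 0)"
    by (rule order_tendstoD(1)[OF f(2) \<alpha>])
  then have "eventually (\<lambda>\<epsilon>. ennreal ((v \<epsilon> s / \<epsilon> ^ d) * (h \<epsilon> / \<epsilon> ^ d) / (f \<epsilon> / \<epsilon> ^ d)\<^sup>2 - 1) =
      rel_error K s g t v \<epsilon>) (at_right 0)"
    using eventually_small v_pos_eventually f(1) h(1)
  proof eventually_elim
    case (elim \<epsilon>)
    then have f0: "f \<epsilon> > 0" and e: "\<epsilon> ^ d > 0" by (auto simp: zero_less_divide_iff)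
    have sq: "(ennreal (f \<epsilon>))\<^sup>2 = ennreal ((f \<epsilon>)\<^sup>2)" using f0 by (simp add: ennreal_power)
    have "rel_error K s g t v \<epsilon> = (ennreal (v \<epsilon> s) * ennreal (h \<epsilon>) - ennreal ((f \<epsilon>)\<^sup>2)) / ennreal ((f \<epsilon>)\<^sup>2)"
      unfolding rel_error_def variance_Q_def expectations[OF elim(2,3)] using elim(4,5) sq by simp
    also have "\<dots> = ennreal (v \<epsilon> s * h \<epsilon> - (f \<epsilon>)\<^sup>2) / ennreal ((f \<epsilon>)\<^sup>2)"
      using v_nonneg[of \<epsilon> s] elim by (simp add: ennreal_mult'[symmetric] ennreal_minus)
    \<comment> \<open>A negative difference would be sent to 0 by \<open>ennreal\<close> on both
      sides, so Cauchy-Schwarz is not invoked.\<close>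
    also have "\<dots> = ennreal ((v \<epsilon> s * h \<epsilon> - (f \<epsilon>)\<^sup>2) / (f \<epsilon>)\<^sup>2)"
    proof (cases "v \<epsilon> s * h \<epsilon> - (f \<epsilon>)\<^sup>2 \<ge> 0")
      case False
      then show ?thesis using f0 by (simp add: ennreal_neg divide_nonpos_pos)
    qed (use f0 in \<open>simp add: divide_ennreal\<close>)
    also have "(v \<epsilon> s * h \<epsilon> - (f \<epsilon>)\<^sup>2) / (f \<epsilon>)\<^sup>2 =
        (v \<epsilon> s / \<epsilon> ^ d) * (h \<epsilon> / \<epsilon> ^ d) / (f \<epsilon> / \<epsilon> ^ d)\<^sup>2 - 1"
      using f0 elim(2) by (simp add: field_simps power2_eq_square)
    finally show ?case ..
  qed
  with lim show ?thesis by (rule Lim_transform_eventually)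
qed

end

section \<open>The two choices of the value function\<close>

context rare_event_chain
begin

text \<open>By the triangle inequality for \<open>dbar\<close> no summand of the ratio is of larger
  order than \<open>v \<epsilon> x\<close>, so each quotient converges. The value of \<gamma> is
  left open, as boundedness depends only on its existence.\<close>

lemma v_dbar_value_function:
  "\<exists>\<gamma>. value_function K \<epsilon>\<^sub>0 s g t (v_dbar K s g t) (\<lambda>_. 1) \<gamma>"
proof -
  let ?v = "v_dbar K s g t"
  have "\<exists>l. ((\<lambda>\<epsilon>. ratio ?v \<epsilon> x) \<longlongrightarrow> l) (at_right 0)" if x: "x \<in> \<Lambda> - {t, g}" and fin: "dbar x \<noteq> \<infinity>" for x
  proof -
    obtain k where k: "dbar x = enat k" using fin by auto
    have "\<exists>l. ((\<lambda>\<epsilon>. pmf (K \<epsilon> x) z * ?v \<epsilon> z / \<epsilon> ^ k) \<longlongrightarrow> l) (at_right 0)" if e: "edge K x z" for z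
    proof (cases "dbar z")
      case (enat j)
      have "x \<notin> \<Gamma>" using x Lam_Gam_disjoint by auto
      then have "k \<le> rate K x z + j" using dbar_Cons[OF enat, of x] x e k by (simp add: mod_step)
      \<comment> \<open>\<open>i\<close> is the slack in the triangle inequality; only successors
        with \<open>i = 0\<close> contribute to the limit.\<close>
      then obtain i where i: "rate K x z + j = k + i" using le_Suc_ex by blast
      have "((\<lambda>\<epsilon>. pmf (K \<epsilon> x) z / \<epsilon> ^ rate K x z * \<epsilon> ^ i) \<longlongrightarrow> step_coeff K x z * (if i = 0 then 1 else 0))
          (at_right 0)"
        by (intro tendsto_mult step_limit[OF e] tendsto_power_at_right_0)
      moreover have "eventually (\<lambda>\<epsilon>. pmf (K \<epsilon> x) z / \<epsilon> ^ rate K x z * \<epsilon> ^ i =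
          pmf (K \<epsilon> x) z * ?v \<epsilon> z / \<epsilon> ^ k) (at_right 0)"
        using eventually_small
      proof eventually_elim
        case (elim \<epsilon>)
        have "\<epsilon> ^ rate K x z * \<epsilon> ^ j = \<epsilon> ^ k * \<epsilon> ^ i" using i by (simp flip: power_add)
        then show ?case using elim by (simp add: v_dbar_def enat field_simps)
      qed
      ultimately show ?thesis by (intro exI) (rule Lim_transform_eventually)
    next
      case infinity
      then show ?thesis by (intro exI[of _ 0]) (simp add: v_dbar_def)
    qed
    then obtain l where l: "\<And>z. edge K x z \<Longrightarrow> ((\<lambda>\<epsilon>. pmf (K \<epsilon> x) z * ?v \<epsilon> z / \<epsilon> ^ k) \<longlongrightarrow> l z) (at_right 0)"
      by metis
    have "((\<lambda>\<epsilon>. \<Sum>z\<in>{z \<in> \<Lambda> \<union> \<Gamma>. edge K x z}. pmf (K \<epsilon> x) z * ?v \<epsilon> z / \<epsilon> ^ k) \<longlongrightarrow>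
        (\<Sum>z\<in>{z \<in> \<Lambda> \<union> \<Gamma>. edge K x z}. l z)) (at_right 0)"
      using l by (intro tendsto_sum) auto
    moreover have "eventually (\<lambda>\<epsilon>. (\<Sum>z\<in>{z \<in> \<Lambda> \<union> \<Gamma>. edge K x z}. pmf (K \<epsilon> x) z * ?v \<epsilon> z / \<epsilon> ^ k) =
        ratio ?v \<epsilon> x) (at_right 0)"
      using eventually_small
    proof eventually_elim
      case (elim \<epsilon>)
      have "?v \<epsilon> x = \<epsilon> ^ k" by (simp add: v_dbar_def k)
      then show ?case
        using infsum_successors[of x \<epsilon> ?v] x elim by (simp add: ratio_def sum_divide_distrib)
    qed
    ultimately show ?thesis by (intro exI) (rule Lim_transform_eventually)
  qed
  then obtain \<gamma> where "\<And>x. x \<in> \<Lambda> - {t, g} \<Longrightarrow> dbar x \<noteq> \<infinity> \<Longrightarrow> ((\<lambda>\<epsilon>. ratio ?v \<epsilon> x) \<longlongrightarrow> \<gamma> x) (at_right 0)"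
    by metis
  moreover have "((\<lambda>\<epsilon>. ?v \<epsilon> x / \<epsilon> ^ k) \<longlongrightarrow> 1) (at_right 0)" if "dbar x = enat k" for x k
  proof -
    have "eventually (\<lambda>\<epsilon>. ?v \<epsilon> x / \<epsilon> ^ k = 1) (at_right 0)"
      using eventually_small by eventually_elim (simp add: v_dbar_def that)
    then show ?thesis by (rule tendsto_eventually)
  qed
  moreover have "?v \<epsilon> x = 1" if "x = g \<or> x \<in> \<Gamma> - {t}" for x \<epsilon>
    using that dbar_goal dbar_Gam by (auto simp: v_dbar_def)
  moreover have "0 \<le> ?v \<epsilon> x" if "\<epsilon> > 0" for x \<epsilon>
    using that by (auto simp: v_dbar_def split: enat.split)
  ultimately show ?thesis
    by (intro exI[of _ \<gamma>] value_function.intro rare_event_chain_axioms value_function_axioms.intro)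
       (auto simp: v_dbar_def)
qed

lemma v_Delta_sum: "x \<in> \<Lambda> \<union> \<Gamma> \<Longrightarrow> v_Delta K s g t \<epsilon> x = (\<Sum>\<omega>\<in>Delta K s g t x. path_prob K\<^sub>m \<epsilon> \<omega>)"
  unfolding v_Delta_def by (intro infsum_finite finite_Delta)

lemma v_Delta_limit:
  assumes "x \<in> \<Lambda> \<union> \<Gamma>" "dbar x = enat k"
  shows "((\<lambda>\<epsilon>. v_Delta K s g t \<epsilon> x / \<epsilon> ^ k) \<longlongrightarrow> (\<Sum>\<omega>\<in>Delta K s g t x. path_coeff K\<^sub>m \<omega>)) (at_right 0)"
proof -
  have "{\<omega> \<in> Delta K s g t x. cost K\<^sub>m \<omega> = k} = Delta K s g t x"
    using assms(2) by (auto simp: Delta_eq)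
  then show ?thesis
    using mod.sum_path_limit[OF finite_Delta[OF assms(1)], of k] assms
    by (simp add: v_Delta_sum) (auto simp: Delta_eq)
qed

text \<open>The numerator is the probability of \<open>X\<close>, the one-step extensions of
  dominant paths. Those of minimal cost are exactly the dominant paths from \<open>x\<close>, and
  the others have higher order, so numerator and denominator have the same leading
  coefficient.\<close>

lemma v_Delta_ratio_limit:
  assumes x: "x \<in> \<Lambda> - {t, g}" and k: "dbar x = enat k"
  shows "((\<lambda>\<epsilon>. ratio (v_Delta K s g t) \<epsilon> x) \<longlongrightarrow> 1) (at_right 0)"
proof -
  let ?v = "v_Delta K s g t"
  let ?Z = "{z \<in> \<Lambda> \<union> \<Gamma>. edge K x z}"
  let ?c = "\<Sum>\<omega>\<in>Delta K s g t x. path_coeff K\<^sub>m \<omega>"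
  define X where "X = (\<Union>z\<in>?Z. (#) x ` Delta K s g t z)"
  have xG: "x \<notin> \<Gamma>" using x Lam_Gam_disjoint by auto
  have finZ: "finite ?Z" using finite_Lam finite_Gam by simp
  then have finX: "finite X" unfolding X_def using finite_Delta by auto
  have X_Phi: "\<omega> \<in> Phi g t x \<and> walk K\<^sub>m \<omega> \<and> k \<le> cost K\<^sub>m \<omega>" if w: "\<omega> \<in> X" for \<omega>
  proof -
    obtain z \<omega>' where z: "z \<in> ?Z" "\<omega> = x # \<omega>'" "\<omega>' \<in> Delta K s g t z" using w X_def by auto
    then have "\<omega>' \<in> Phi g t z" "walk K\<^sub>m \<omega>'" by (simp_all add: Delta_eq)
    moreover from this obtain \<omega>'' where "\<omega>' = z # \<omega>''" by (cases \<omega>') (auto dest: Phi_hd)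
    ultimately have "\<omega> \<in> Phi g t x" "walk K\<^sub>m \<omega>"
      using z x xG Phi_Cons[of x t g] by (auto simp: mod_step)
    then show ?thesis using dbar_le[of \<omega> x] k by simp
  qed
  have X_Delta: "{\<omega> \<in> X. cost K\<^sub>m \<omega> = k} = Delta K s g t x"
  proof (intro set_eqI iffI)
    fix \<omega> assume "\<omega> \<in> {\<omega> \<in> X. cost K\<^sub>m \<omega> = k}"
    then show "\<omega> \<in> Delta K s g t x" using X_Phi k by (simp add: Delta_eq)
  next
    fix \<omega> assume "\<omega> \<in> Delta K s g t x"
    then have w: "\<omega> \<in> Phi g t x" "walk K\<^sub>m \<omega>" "cost K\<^sub>m \<omega> = k" using k by (auto simp: Delta_eq)
    from w(1) show "\<omega> \<in> {\<omega> \<in> X. cost K\<^sub>m \<omega> = k}"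
    proof (cases rule: Phi_cases)
      case (2 z \<omega>')
      then have e: "edge K x z" "walk K\<^sub>m (z # \<omega>')" using w xG by (simp_all add: mod_step)
      then have z: "z \<in> ?Z" using edge_Lam x by auto
      have le: "dbar z \<le> enat (cost K\<^sub>m (z # \<omega>'))" using 2 e dbar_le by blast
      then obtain j where j: "dbar z = enat j" by (cases "dbar z") auto
      then have "dbar x \<le> enat (rate K\<^sub>m x z + j)" using 2 w by (intro dbar_Cons) auto
      \<comment> \<open>The tail of a dominant path is dominant, since a cheaper continuation from
        \<open>z\<close> would bring \<open>x\<close> closer to \<open>g\<close>.\<close>
      then have "dbar z = enat (cost K\<^sub>m (z # \<omega>'))" using le j k w(3) 2 by simp
      then have "z # \<omega>' \<in> Delta K s g t z" using 2 e by (simp add: Delta_eq)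
      then show ?thesis using w z 2 unfolding X_def by blast
    qed (use x in simp)
  qed
  have "eventually (\<lambda>\<epsilon>. (\<Sum>\<omega>\<in>X. path_prob K\<^sub>m \<epsilon> \<omega>) / \<epsilon> ^ k / (?v \<epsilon> x / \<epsilon> ^ k) = ratio ?v \<epsilon> x) (at_right 0)"
    using eventually_small
  proof eventually_elim
    case (elim \<epsilon>)
    \<comment> \<open>The second state of a path tells the pieces of \<open>X\<close> apart.\<close>
    have "(\<Sum>\<omega>\<in>X. path_prob K\<^sub>m \<epsilon> \<omega>) = (\<Sum>z\<in>?Z. \<Sum>\<omega>\<in>(#) x ` Delta K s g t z. path_prob K\<^sub>m \<epsilon> \<omega>)"
      unfolding X_def using finZ finite_Delta
      by (intro sum.UNION_disjoint) (auto simp: Delta_eq dest!: Phi_hd)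
    also have "\<dots> = (\<Sum>z\<in>?Z. pmf (K \<epsilon> x) z * ?v \<epsilon> z)"
    proof (intro sum.cong refl)
      fix z assume z: "z \<in> ?Z"
      have "path_prob K\<^sub>m \<epsilon> (x # \<omega>) = pmf (K \<epsilon> x) z * path_prob K\<^sub>m \<epsilon> \<omega>" if "\<omega> \<in> Delta K s g t z" for \<omega>
        using that xG by (cases \<omega>) (auto simp: Delta_eq mod_chain_other dest!: Phi_hd)
      then show "(\<Sum>\<omega>\<in>(#) x ` Delta K s g t z. path_prob K\<^sub>m \<epsilon> \<omega>) = pmf (K \<epsilon> x) z * ?v \<epsilon> z"
        using z by (simp add: sum.reindex v_Delta_sum sum_distrib_left)
    qed
    also have "\<dots> = (\<Sum>\<^sub>\<infinity>z. pmf (K\<^sub>m \<epsilon> x) z * ?v \<epsilon> z)"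
      using infsum_successors[of x \<epsilon> ?v] x elim by simp
    finally show ?case using elim by (simp add: ratio_def)
  qed
  moreover have "((\<lambda>\<epsilon>. (\<Sum>\<omega>\<in>X. path_prob K\<^sub>m \<epsilon> \<omega>) / \<epsilon> ^ k / (?v \<epsilon> x / \<epsilon> ^ k)) \<longlongrightarrow> ?c / ?c) (at_right 0)"
    using mod.sum_path_limit[OF finX, of k] X_Phi v_Delta_limit[OF _ k] sum_path_coeff_pos[OF _ k] x
    by (intro tendsto_divide) (auto simp: X_Delta)
  ultimately have "((\<lambda>\<epsilon>. ratio ?v \<epsilon> x) \<longlongrightarrow> ?c / ?c) (at_right 0)"
    by (rule Lim_transform_eventually[rotated])
  moreover have "?c / ?c = 1" using sum_path_coeff_pos[OF _ k] x by simp
  ultimately show ?thesis by simp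
qed

lemma v_Delta_value_function:
  "value_function K \<epsilon>\<^sub>0 s g t (v_Delta K s g t) (\<lambda>x. \<Sum>\<omega>\<in>Delta K s g t x. path_coeff K\<^sub>m \<omega>) (\<lambda>_. 1)"
proof (intro value_function.intro rare_event_chain_axioms value_function_axioms.intro)
  let ?v = "v_Delta K s g t"
  fix \<epsilon> :: real and x assume e: "\<epsilon> > 0"
  show "0 \<le> ?v \<epsilon> x" unfolding v_Delta_def by (intro infsum_nonneg) simp
  show "?v \<epsilon> x = 0" if "dbar x = \<infinity>"
    using that by (simp add: v_Delta_def Delta_eq)
  show "?v \<epsilon> x = 1" if "x = g \<or> x \<in> \<Gamma> - {t}"
    using that
  proof
    assume x: "x = g"
    have "Delta K s g t g = {[g]}" by (auto simp: Delta_eq dbar_goal)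
    then show ?thesis using x by (simp add: v_Delta_sum)
  next
    assume x: "x \<in> \<Gamma> - {t}"
    have "Delta K s g t x = {[x, g]}"
    proof
      show "Delta K s g t x \<subseteq> {[x, g]}"
      proof
        fix \<omega> assume "\<omega> \<in> Delta K s g t x"
        then have "\<omega> \<in> Phi g t x" "walk K\<^sub>m \<omega>" by (simp_all add: Delta_eq)
        then show "\<omega> \<in> {[x, g]}" using Phi_Gam x by blast
      qed
      have "[x, g] \<in> Delta K s g t x"
        unfolding Delta_eq using x mod_path_Gam[of x] dbar_Gam[of x] by simp
      then show "{[x, g]} \<subseteq> Delta K s g t x" by simp
    qed
    then show ?thesis using x mod_path_Gam(4)[of x \<epsilon>] by (simp add: v_Delta_sum)
  qed
qed (use v_Delta_limit v_Delta_ratio_limit sum_path_coeff_pos in auto)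

lemma v_Delta_vanishing: "((\<lambda>\<epsilon>. rel_error K s g t (v_Delta K s g t) \<epsilon>) \<longlongrightarrow> 0) (at_right 0)"
proof -
  interpret value_function K \<epsilon>\<^sub>0 s g t "v_Delta K s g t"
    "\<lambda>x. \<Sum>\<omega>\<in>Delta K s g t x. path_coeff K\<^sub>m \<omega>" "\<lambda>_. 1"
    by (rule v_Delta_value_function)
  let ?\<alpha> = "\<Sum>\<omega>\<in>Delta K s g t s. path_coeff K \<omega>"
  \<comment> \<open>By \<open>dbar_finite\<close> a walk to \<open>g\<close> meets only states of
    finite distance up to its exit, where \<open>\<gamma>\<^sub>0\<close> is 1 and not the default
    0.\<close>
  have "weight (\<Lambda> - {g}) \<gamma>\<^sub>0 \<omega> = 1" if "\<omega> \<in> Phi g t x" "walk K \<omega>" "x \<in> \<Lambda> \<union> \<Gamma>" for \<omega> x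
    using that
  proof (induction rule: Phi_induct)
    case (step x y \<omega>)
    have "x # y # \<omega> \<in> Phi g t x" using step by (intro Phi_Cons) auto
    then have "dbar x \<noteq> \<infinity>" using dbar_finite step by blast
    then show ?case using step edge_Lam by (auto simp: \<gamma>\<^sub>0_def)
  qed simp
  then have "(\<Sum>\<omega>\<in>Delta K s g t s. path_coeff K \<omega> * weight (\<Lambda> - {g}) \<gamma>\<^sub>0 \<omega>) = ?\<alpha>"
    by (intro sum.cong) (auto simp: Delta_start_eq)
  moreover have "?\<alpha> > 0"
    using sum_path_coeff_pos[of s d] dbar_start by (simp add: Delta_start_coeff)
  ultimately show ?thesis
    using rel_error_tendsto by (simp add: Delta_start_coeff power2_eq_square)
qed

lemma v_dbar_bounded: "is_O (\<lambda>\<epsilon>. rel_error K s g t (v_dbar K s g t) \<epsilon>) (\<lambda>\<epsilon>. 1)"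
proof -
  obtain \<gamma> where "value_function K \<epsilon>\<^sub>0 s g t (v_dbar K s g t) (\<lambda>_. 1) \<gamma>"
    using v_dbar_value_function by blast
  then interpret value_function K \<epsilon>\<^sub>0 s g t "v_dbar K s g t" "\<lambda>_. 1" \<gamma> .
  show ?thesis unfolding is_O_def
    \<comment> \<open>The limit is the image of a real number under \<open>ennreal\<close>, hence
      finite; the number itself is supplied by \<open>rel_error_tendsto\<close>.\<close>
    by (intro exI conjI, rule ennreal_less_top[folded infinity_ennreal_def])
       (use rel_error_tendsto in \<open>simp add: divide_ennreal_def\<close>)
qed

end

theorem corollary4p8:
  fixes K :: "real \<Rightarrow> 'a::countable \<Rightarrow> 'a pmf"
    and s g t :: 'a
    and \<epsilon>\<^sub>0 :: real
  assumes eps0: "\<epsilon>\<^sub>0 > 0"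
    and distinguished: "s \<noteq> g" "s \<noteq> t"
    and absorbing: "\<And>\<epsilon>. \<epsilon> \<in> {0<..<\<epsilon>\<^sub>0} \<Longrightarrow> pmf (K \<epsilon> g) g = 1 \<and> pmf (K \<epsilon> t) t = 1"
    and rates: "\<And>x z. (\<forall>\<epsilon>\<in>{0<..<\<epsilon>\<^sub>0}. pmf (K \<epsilon> x) z = 0) \<or>
                  ((\<forall>\<epsilon>\<in>{0<..<\<epsilon>\<^sub>0}. pmf (K \<epsilon> x) z > 0) \<and>
                   (\<exists>r::nat. is_Theta (\<lambda>\<epsilon>. pmf (K \<epsilon> x) z) (\<lambda>\<epsilon>. \<epsilon> ^ r)))"
    and finite_Lam: "finite (Lam K s g t)"
    and finite_Gam: "finite (Gam K s g t)"
    and goal_reachable: "dis K g t s g < \<infinity>"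
    and stops: "\<And>\<epsilon>. \<epsilon> \<in> {0<..<\<epsilon>\<^sub>0} \<Longrightarrow>
                  (\<integral>\<^sup>+ \<omega>. ennreal (path_prob K \<epsilon> \<omega>) \<partial>count_space (stopped_paths g t s)) = 1"
    and no_high_prob_cycle:
      "\<And>\<omega>. length \<omega> \<ge> 2 \<Longrightarrow> last \<omega> = hd \<omega> \<Longrightarrow>
             is_Theta (\<lambda>\<epsilon>. path_prob K \<epsilon> \<omega>) (\<lambda>\<epsilon>. \<epsilon> ^ 0) \<Longrightarrow> set \<omega> = {g} \<or> set \<omega> = {t}"
  shows "((\<lambda>\<epsilon>. rel_error K s g t (v_Delta K s g t) \<epsilon>) \<longlongrightarrow> 0) (at_right 0) \<and>
         is_O (\<lambda>\<epsilon>. rel_error K s g t (v_dbar K s g t) \<epsilon>) (\<lambda>\<epsilon>. 1)"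
proof -
  interpret rare_event_chain K \<epsilon>\<^sub>0 s g t
    using assms by (intro rare_event_chain.intro graded_chain.intro rare_event_chain_axioms.intro)
  show ?thesis using v_Delta_vanishing v_dbar_bounded by blast
qed

end
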